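(* Let $d\ge 2$ and let $\hat H$ be the $S=\frac12$ nearest-neighbor Hamiltonian on the periodic hypercubic lattice $\Lambda=\{1,\dots,L\}^d$ with parameters $J_{\mathrm X},J_{\mathrm Y},J_{\mathrm Z},h_{\mathrm X},h_{\mathrm Y},h_{\mathrm Z}\in\mathbb R$ satisfying $J_{\mathrm X}\neq 0$ and $J_{\mathrm Y}\ne 0$. Then for every integer $k_{\max}$ with $3\le k_{\max}\le L/2$ there is no local conserved quantity with maximum width $k_{\max}$; that is, there is no operator $$\hat Q=\sum_{\boldsymbol{\hat A}\in\mathcal P_\Lambda,\ \operatorname{Wid}\boldsymbol{\hat A}\le k_{\max}} q_{\boldsymbol{\hat A}}\,\boldsymbol{\hat A},\qquad q_{\boldsymbol{\hat A}}\in\mathbb C,$$ with $q_{\boldsymbol{\hat A}}\neq 0$ for at least one $\boldsymbol{\hat A}$ with $\operatorname{Wid}\boldsymbol{\hat A}=k_{\max}$, such that $[\hat H,\hat Q]=0$.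
   Context: $\Lambda=\{1,\dots,L\}^d$ is the $d$-dimensional hypercubic lattice with periodic boundary conditions (coordinates mod $L$). For $u,v\in\Lambda$, $|u-v|=1$ means that $u,v$ are nearest neighbors, i.e. they differ by $\pm1$ (mod $L$) in exactly one coordinate and agree in the others. Each site carries a copy of $\mathbb C^2$; $\hat X_u,\hat Y_u,\hat Z_u,\hat I_u$ are the Pauli matrices and the identity acting at site $u$ (tensored with the identity elsewhere). The Hamiltonian is $$\hat H=-\frac12\sum_{u,v\in\Lambda,\ |u-v|=1}\{J_{\mathrm X}\hat X_u\hat X_v+J_{\mathrm Y}\hat Y_u\hat Y_v+J_{\mathrm Z}\hat Z_u\hat Z_v\}-\sum_{u\in\Lambda}\{h_{\mathrm X}\hat X_u+h_{\mathrm Y}\hat Y_u+h_{\mathrm Z}\hat Z_u\},$$ the first sum being over ordered pairs. A product (of Pauli matrices) is an operator $\boldsymbol{\hat A}=\bigotimes_{u\in S}\hat A_u$ (tensored with the identity on $\Lambda\setminus S$) with $S\subset\Lambda$ nonempty and $\hat A_u\in\{\hat X_u,\hat Y_u,\hat Z_u\}$; $\operatorname{Supp}\boldsymbol{\hat A}=S$. $\mathcal P_\Lambda$ is the set of all products. For nonempty $S\subset\Lambda$ and $\alpha\in\{1,\dots,d\}$, $\operatorname{Wid}_\alpha S$ is the minimum $k$ for which there is $a\in\{1,\dots,L\}$ such that for every $u\in S$ the residue mod $L$ of $(u)_\alpha-a$ lies in $\{0,\dots,k-1\}$, where $(u)_\alpha$ is the $\alpha$-th coordinate. $\operatorname{Wid}S=\max_\alpha\operatorname{Wid}_\alpha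 S$, $\operatorname{Wid}_\alpha\boldsymbol{\hat A}=\operatorname{Wid}_\alpha\operatorname{Supp}\boldsymbol{\hat A}$, and $\operatorname{Wid}\boldsymbol{\hat A}=\operatorname{Wid}\operatorname{Supp}\boldsymbol{\hat A}$. No translation invariance is assumed of the coefficients $q_{\boldsymbol{\hat A}}$. *)

theory Defs
  imports "HOL-Analysis.Analysis" "HOL-Number_Theory.Cong"
begin

type_synonym site = "nat \<Rightarrow> int"

definition lattice :: "nat \<Rightarrow> nat \<Rightarrow> site set" where
  "lattice L d = {1..d} \<rightarrow>\<^sub>E {1..int L}"

definition nearest_nbr :: "nat \<Rightarrow> nat \<Rightarrow> site \<Rightarrow> site \<Rightarrow> bool" where
  "nearest_nbr L d u v \<longleftrightarrow>
     (\<exists>\<alpha>\<in>{1..d}. ([u \<alpha> - v \<alpha> = 1] (mod int L) \<or> [u \<alpha> - v \<alpha> = - 1] (mod int L)) \<and>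
        (\<forall>\<beta>\<in>{1..d} - {\<alpha>}. u \<beta> = v \<beta>))"

text \<open>The Hilbert space is the tensor product of one copy of \<open>\<complex>\<^sup>2\<close> per site. Its standard
  basis is indexed by the functions assigning to every site one of the two basis
  vectors of \<open>\<complex>\<^sup>2\<close>; an operator is given by its matrix in this basis. Only matrix entries
  with both indices in \<open>configs L d\<close> are meaningful.\<close>

type_synonym config = "site \<Rightarrow> 2"
type_synonym operator = "config \<Rightarrow> config \<Rightarrow> complex"

definition configs :: "nat \<Rightarrow> nat \<Rightarrow> config set" where
  "configs L d = lattice L d \<rightarrow>\<^sub>E UNIV"

definition op_mult :: "nat \<Rightarrow> nat \<Rightarrow> operator \<Rightarrow> operator \<Rightarrow> operator" where
  "op_mult L d A B = (\<lambda>\<sigma> \<tau>. \<Sum>\<rho>\<in>configs L d. A \<sigma> \<rho> * B \<rho> \<tau>)"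

definition commutator :: "nat \<Rightarrow> nat \<Rightarrow> operator \<Rightarrow> operator \<Rightarrow> operator" where
  "commutator L d A B = (\<lambda>\<sigma> \<tau>. op_mult L d A B \<sigma> \<tau> - op_mult L d B A \<sigma> \<tau>)"

definition op_eq :: "nat \<Rightarrow> nat \<Rightarrow> operator \<Rightarrow> operator \<Rightarrow> bool" where
  "op_eq L d A B \<longleftrightarrow> (\<forall>\<sigma>\<in>configs L d. \<forall>\<tau>\<in>configs L d. A \<sigma> \<tau> = B \<sigma> \<tau>)"

definition tensor :: "nat \<Rightarrow> nat \<Rightarrow> (site \<Rightarrow> complex^2^2) \<Rightarrow> operator" where
  "tensor L d M = (\<lambda>\<sigma> \<tau>. \<Prod>u\<in>lattice L d. M u $ \<sigma> u $ \<tau> u)"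

datatype pauli = PX | PY | PZ

fun pauli_mat :: "pauli \<Rightarrow> complex^2^2" where
  "pauli_mat PX = vector [vector [0, 1], vector [1, 0]]"
| "pauli_mat PY = vector [vector [0, - \<i>], vector [\<i>, 0]]"
| "pauli_mat PZ = vector [vector [1, 0], vector [0, - 1]]"

definition site_pauli :: "nat \<Rightarrow> nat \<Rightarrow> pauli \<Rightarrow> site \<Rightarrow> operator" where
  "site_pauli L d P u = tensor L d (\<lambda>w. if w = u then pauli_mat P else mat 1)"

definition hamiltonian ::
    "nat \<Rightarrow> nat \<Rightarrow> real \<Rightarrow> real \<Rightarrow> real \<Rightarrow> real \<Rightarrow> real \<Rightarrow> real \<Rightarrow> operator" where
  "hamiltonian L d JX JY JZ hX hY hZ = (\<lambda>\<sigma> \<tau>.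
     - (1/2) * (\<Sum>(u, v) | u \<in> lattice L d \<and> v \<in> lattice L d \<and> nearest_nbr L d u v.
          of_real JX * op_mult L d (site_pauli L d PX u) (site_pauli L d PX v) \<sigma> \<tau>
        + of_real JY * op_mult L d (site_pauli L d PY u) (site_pauli L d PY v) \<sigma> \<tau>
        + of_real JZ * op_mult L d (site_pauli L d PZ u) (site_pauli L d PZ v) \<sigma> \<tau>)
     - (\<Sum>u\<in>lattice L d.
          of_real hX * site_pauli L d PX u \<sigma> \<tau>
        + of_real hY * site_pauli L d PY u \<sigma> \<tau>
        + of_real hZ * site_pauli L d PZ u \<sigma> \<tau>))"

text \<open>A product of Pauli matrices is encoded by the partial map \<open>A\<close> sending each site of its
  support \<open>dom A\<close> to the Pauli matrix sitting there; distinct maps give distinct operators.\<close>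

definition pauli_products :: "nat \<Rightarrow> nat \<Rightarrow> (site \<rightharpoonup> pauli) set" where
  "pauli_products L d = {A. dom A \<subseteq> lattice L d \<and> dom A \<noteq> {}}"

definition product_op :: "nat \<Rightarrow> nat \<Rightarrow> (site \<rightharpoonup> pauli) \<Rightarrow> operator" where
  "product_op L d A =
     tensor L d (\<lambda>u. case A u of None \<Rightarrow> mat 1 | Some P \<Rightarrow> pauli_mat P)"

definition width_dir :: "nat \<Rightarrow> nat \<Rightarrow> site set \<Rightarrow> nat" where
  "width_dir L \<alpha> S =
     (LEAST k. \<exists>a\<in>{1..int L}. \<forall>u\<in>S. (u \<alpha> - a) mod int L \<in> {0..<int k})"

definition width :: "nat \<Rightarrow> nat \<Rightarrow> site set \<Rightarrow> nat" where
  "width L d S = Max ((\<lambda>\<alpha>. width_dir L \<alpha> S) ` {1..d})"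

definition local_conserved_quantity ::
    "nat \<Rightarrow> nat \<Rightarrow> operator \<Rightarrow> nat \<Rightarrow> operator \<Rightarrow> bool" where
  "local_conserved_quantity L d H k Q \<longleftrightarrow>
     (\<exists>q :: (site \<rightharpoonup> pauli) \<Rightarrow> complex.
        op_eq L d Q (\<lambda>\<sigma> \<tau>. \<Sum>A | A \<in> pauli_products L d \<and> width L d (dom A) \<le> k.
                       q A * product_op L d A \<sigma> \<tau>) \<and>
        (\<exists>A\<in>pauli_products L d. width L d (dom A) = k \<and> q A \<noteq> 0)) \<and>
     op_eq L d (commutator L d H Q) (\<lambda>\<sigma> \<tau>. 0)"

end

theory Submission
  imports Defs
begin

text \<open>
  Taking the trace of \<open>W [H, Q]\<close> for every Pauli string \<open>W\<close> turns \<open>[H, Q] = 0\<close> into linear relations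
  between the coefficients \<open>q\<close>: a relation has one term for every summand \<open>P\<close> of \<open>H\<close> that
  anticommutes with \<open>W\<close>, and it involves \<open>q (W P)\<close>. A string \<open>W\<close> of width \<open>k + 1\<close> can only be
  shortened to width \<open>k\<close> by removing an end site that is alone in its layer, so appending a bond to
  one end of a string \<open>A\<close> of width \<open>k\<close> with \<open>q A \<noteq> 0\<close> forces the opposite end to be removable.
  Repeating this shows that \<open>A\<close> is a straight line, and after \<open>k\<close> shifts with bonds \<open>XX\<close>, \<open>YY\<close>
  alternately one finds a line \<open>l Z \<dots> Z r\<close> with \<open>l, r \<in> {X, Y}\<close> and a nonzero coefficient, which
  is nonzero for all shifted lines too.

  Since \<open>d \<ge> 2\<close>, a bond \<open>S\<close> can be attached at a fixed site \<open>u\<close> of the line in a second direction. The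
  relation for a line with \<open>S\<close> attached involves the coefficient of the bare line and of the two lines of
  length \<open>k - 1\<close>, with \<open>S\<close> attached, obtained by removing an end. Let the line slide past \<open>u\<close>: these
  relations telescope, the terms at both extremes of the sum vanish for a suitable Pauli matrix
  in \<open>S\<close>, and what remains is a positive multiple of the coefficient of the bare line.
\<close>

section \<open>Pauli strings and traces\<close>

lemma UNIV_pauli: "(UNIV :: pauli set) = {PX, PY, PZ}"
  by (auto intro: pauli.exhaust)

instance pauli :: finite
  by standard (simp add: UNIV_pauli)

text \<open>Modulo scalars the Pauli matrices and the identity (\<open>None\<close>) form the Klein
  four-group. The scalar of a product is kept apart in \<open>phase\<close>, so that supports and
  signs can be treated separately.\<close>

fun pmul :: "pauli option \<Rightarrow> pauli option \<Rightarrow> pauli option" where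
  "pmul None b = b"
| "pmul a None = a"
| "pmul (Some PX) (Some PX) = None"
| "pmul (Some PY) (Some PY) = None"
| "pmul (Some PZ) (Some PZ) = None"
| "pmul (Some PX) (Some PY) = Some PZ"
| "pmul (Some PY) (Some PX) = Some PZ"
| "pmul (Some PY) (Some PZ) = Some PX"
| "pmul (Some PZ) (Some PY) = Some PX"
| "pmul (Some PZ) (Some PX) = Some PY"
| "pmul (Some PX) (Some PZ) = Some PY"

fun phase :: "pauli option \<Rightarrow> pauli option \<Rightarrow> complex" where
  "phase (Some PX) (Some PY) = \<i>"
| "phase (Some PY) (Some PX) = - \<i>"
| "phase (Some PY) (Some PZ) = \<i>"
| "phase (Some PZ) (Some PY) = - \<i>"
| "phase (Some PZ) (Some PX) = \<i>"
| "phase (Some PX) (Some PZ) = - \<i>"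
| "phase _ _ = 1"

definition pmat :: "pauli option \<Rightarrow> complex^2^2" where
  "pmat a = (case a of None \<Rightarrow> mat 1 | Some P \<Rightarrow> pauli_mat P)"

lemma option_pauli_cases:
  fixes a :: "pauli option"
  obtains "a = None" | "a = Some PX" | "a = Some PY" | "a = Some PZ"
  by (metis option.exhaust pauli.exhaust)

lemma pmat_mult: "pmat a ** pmat b = (\<chi> i j. phase a b * pmat (pmul a b) $ i $ j)"
  by (cases a rule: option_pauli_cases; cases b rule: option_pauli_cases)
     (simp_all add: pmat_def vec_eq_iff forall_2 matrix_matrix_mult_def sum_2 mat_def)

lemma trace_pmat_mult: "trace (pmat a ** pmat b) = (if a = b then 2 else 0)"
  by (cases a rule: option_pauli_cases; cases b rule: option_pauli_cases)
     (simp_all add: pmat_def trace_def matrix_matrix_mult_def sum_2 mat_def)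

lemma pmul_cancel: "pmul (pmul a b) b = a"
  by (cases a rule: option_pauli_cases; cases b rule: option_pauli_cases) simp_all

lemma pmul_comm: "pmul a b = pmul b a"
  by (cases a rule: option_pauli_cases; cases b rule: option_pauli_cases) simp_all

lemma pmul_assoc: "pmul (pmul a b) c = pmul a (pmul b c)"
  by (cases a rule: option_pauli_cases; cases b rule: option_pauli_cases;
      cases c rule: option_pauli_cases) simp_all

lemma pmul_None_right [simp]: "pmul a None = a"
  by (cases a) simp_all

lemma phase_None [simp]: "phase None a = 1" "phase a None = 1"
  by (cases a rule: option_pauli_cases; simp)+

text \<open>Both sides are the scalar of a triple matrix product, so this is associativity read off
  on the phases.\<close>

lemma phase_cocycle: "phase a b * phase (pmul a b) c = phase b c * phase a (pmul b c)"
  by (cases a rule: option_pauli_cases; cases b rule: option_pauli_cases;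
      cases c rule: option_pauli_cases) simp_all

definition smul :: "(site \<rightharpoonup> pauli) \<Rightarrow> (site \<rightharpoonup> pauli) \<Rightarrow> (site \<rightharpoonup> pauli)" where
  "smul A B = (\<lambda>u. pmul (A u) (B u))"

definition sphase :: "site set \<Rightarrow> (site \<rightharpoonup> pauli) \<Rightarrow> (site \<rightharpoonup> pauli) \<Rightarrow> complex" where
  "sphase \<Lambda> A B = (\<Prod>u\<in>\<Lambda>. phase (A u) (B u))"

text \<open>Symmetric in \<open>u\<close> and \<open>v\<close>. For \<open>u = v\<close> it
  degenerates to a single-site string, so distinctness of the ends has to be tracked wherever a
  genuine bond is meant.\<close>

definition bond :: "site \<Rightarrow> site \<Rightarrow> pauli \<Rightarrow> (site \<rightharpoonup> pauli)" where
  "bond u v t = (\<lambda>w. if w = u \<or> w = v then Some t else None)"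

lemma finite_lattice [simp]: "finite (lattice L d)"
  by (simp add: lattice_def finite_PiE)

text \<open>A sum over configurations of a product over sites factorizes site by site.\<close>

lemma tensor_mult:
  "op_mult L d (tensor L d M) (tensor L d N) = tensor L d (\<lambda>u. M u ** N u)"
proof (intro ext)
  fix \<sigma> \<tau>
  have "op_mult L d (tensor L d M) (tensor L d N) \<sigma> \<tau>
      = (\<Sum>\<rho>\<in>lattice L d \<rightarrow>\<^sub>E UNIV. \<Prod>u\<in>lattice L d. M u $ \<sigma> u $ \<rho> u * N u $ \<rho> u $ \<tau> u)"
    by (simp add: op_mult_def tensor_def prod.distrib configs_def)
  also have "\<dots> = (\<Prod>u\<in>lattice L d. \<Sum>x\<in>UNIV. M u $ \<sigma> u $ x * N u $ x $ \<tau> u)"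
    by (rule prod_sum_PiE [symmetric, of _ "\<lambda>_. UNIV"]) simp_all
  finally show "op_mult L d (tensor L d M) (tensor L d N) \<sigma> \<tau> = tensor L d (\<lambda>u. M u ** N u) \<sigma> \<tau>"
    by (simp add: tensor_def matrix_matrix_mult_def)
qed


section \<open>Traces of string products and of commutators\<close>

definition optrace :: "nat \<Rightarrow> nat \<Rightarrow> operator \<Rightarrow> complex" where
  "optrace L d A = (\<Sum>\<sigma>\<in>configs L d. A \<sigma> \<sigma>)"

lemma optrace_tensor: "optrace L d (tensor L d M) = (\<Prod>u\<in>lattice L d. trace (M u))"
  unfolding optrace_def tensor_def configs_def trace_def
  by (rule prod_sum_PiE [symmetric, of _ "\<lambda>_. UNIV"]) simp_all

lemma optrace_mult_commute: "optrace L d (op_mult L d A B) = optrace L d (op_mult L d B A)"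
  unfolding optrace_def op_mult_def by (subst sum.swap) (simp add: mult.commute)

lemma op_mult_assoc: "op_mult L d (op_mult L d A B) C = op_mult L d A (op_mult L d B C)"
  unfolding op_mult_def sum_distrib_left sum_distrib_right
  by (intro ext, subst sum.swap) (simp add: mult.assoc)

lemma product_op_pmat: "product_op L d A = tensor L d (\<lambda>u. pmat (A u))"
  unfolding product_op_def pmat_def ..

lemma trace_pmat_mult3:
  "trace ((pmat a ** pmat b) ** pmat c) = phase a b * (if pmul a b = c then 2 else 0)"
proof -
  have "trace ((pmat a ** pmat b) ** pmat c) = phase a b * trace (pmat (pmul a b) ** pmat c)"
    unfolding pmat_mult [of a b]
    by (simp add: trace_def matrix_matrix_mult_def sum_distrib_left mult.assoc)
  then show ?thesis by (simp add: trace_pmat_mult)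
qed

lemma prod_indicator_const:
  assumes "finite S"
  shows "(\<Prod>u\<in>S. if P u then c else 0) = (if \<forall>u\<in>S. P u then c ^ card S else (0::complex))"
  using assms by (induction S) auto

text \<open>Nontrivial Pauli matrices are traceless, so only the string that equals
  \<open>A B\<close> up to phase has a nonzero trace against it. This is what lets a trace pick out
  a single coefficient.\<close>

lemma optrace_product3:
  assumes "dom A \<subseteq> lattice L d" "dom B \<subseteq> lattice L d" "dom C \<subseteq> lattice L d"
  shows "optrace L d (op_mult L d (op_mult L d (product_op L d A) (product_op L d B)) (product_op L d C))
    = sphase (lattice L d) A B * (if smul A B = C then 2 ^ card (lattice L d) else 0)"
proof -
  have "(\<forall>u\<in>lattice L d. pmul (A u) (B u) = C u) \<longleftrightarrow> smul A B = C"
  proof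
    assume *: "\<forall>u\<in>lattice L d. pmul (A u) (B u) = C u"
    show "smul A B = C"
    proof
      fix u
      show "smul A B u = C u"
      proof (cases "u \<in> lattice L d")
        case False
        then have "A u = None" "B u = None" "C u = None" using assms by (auto simp: dom_def)
        then show ?thesis by (simp add: smul_def)
      qed (use * in \<open>simp add: smul_def\<close>)
    qed
  qed (auto simp: smul_def)
  then show ?thesis
    by (simp add: product_op_pmat tensor_mult optrace_tensor trace_pmat_mult3 sphase_def
        prod.distrib prod_indicator_const)
qed

text \<open>The trace of \<open>W [A, Q]\<close>, written with indices so that only matrix entries
  on \<open>configs\<close> enter.\<close>

definition opair :: "nat \<Rightarrow> nat \<Rightarrow> operator \<Rightarrow> operator \<Rightarrow> operator \<Rightarrow> complex" where
  "opair L d W Q A = (\<Sum>\<sigma>\<in>configs L d. \<Sum>\<tau>\<in>configs L d. W \<tau> \<sigma> * commutator L d A Q \<sigma> \<tau>)"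

lemma commutator_cong_right:
  assumes "op_eq L d Q Q'" "\<sigma> \<in> configs L d" "\<tau> \<in> configs L d"
  shows "commutator L d A Q \<sigma> \<tau> = commutator L d A Q' \<sigma> \<tau>"
  using assms by (simp add: commutator_def op_mult_def op_eq_def)

text \<open>Cyclicity of the trace turns \<open>W Q A\<close> into \<open>A W Q\<close>; with
  \<open>Q\<close> as the last factor its expansion into strings can be inserted.\<close>

lemma opair_alt:
  "opair L d W Q A = optrace L d (op_mult L d (op_mult L d W A) Q)
      - optrace L d (op_mult L d (op_mult L d A W) Q)"
proof -
  have *: "(\<Sum>\<sigma>\<in>configs L d. \<Sum>\<tau>\<in>configs L d. W \<tau> \<sigma> * B \<sigma> \<tau>) = optrace L d (op_mult L d W B)" for B
    unfolding optrace_def op_mult_def by (rule sum.swap)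
  have "opair L d W Q A = optrace L d (op_mult L d W (op_mult L d A Q))
      - optrace L d (op_mult L d W (op_mult L d Q A))"
    by (simp add: opair_def commutator_def right_diff_distrib sum_subtractf *)
  moreover have "optrace L d (op_mult L d W (op_mult L d Q A))
    = optrace L d (op_mult L d (op_mult L d A W) Q)"
    by (metis op_mult_assoc optrace_mult_commute)
  ultimately show ?thesis by (simp add: op_mult_assoc)
qed

lemma op_mult_sum_right:
  "op_mult L d A (\<lambda>\<sigma> \<tau>. \<Sum>x\<in>X. c x * B x \<sigma> \<tau>) = (\<lambda>\<sigma> \<tau>. \<Sum>x\<in>X. c x * op_mult L d A (B x) \<sigma> \<tau>)"
  unfolding op_mult_def sum_distrib_left
  by (intro ext, subst sum.swap) (simp add: mult.left_commute)

lemma optrace_sum: "optrace L d (\<lambda>\<sigma> \<tau>. \<Sum>x\<in>X. c x * B x \<sigma> \<tau>) = (\<Sum>x\<in>X. c x * optrace L d (B x))"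
  unfolding optrace_def sum_distrib_left by (rule sum.swap)

text \<open>Of the expansion of \<open>Q\<close> only the string \<open>smul W P\<close> survives
  the trace. It is met once through \<open>W P\<close> and once through \<open>P W\<close>, with the
  respective phases; the power of 2 is the trace of the identity.\<close>

lemma opair_product:
  assumes "finite X" "\<And>A. A \<in> X \<Longrightarrow> dom A \<subseteq> lattice L d"
    and "dom W \<subseteq> lattice L d" "dom P \<subseteq> lattice L d"
  shows "opair L d (product_op L d W) (\<lambda>\<sigma> \<tau>. \<Sum>A\<in>X. q A * product_op L d A \<sigma> \<tau>) (product_op L d P)
    = 2 ^ card (lattice L d) * ((sphase (lattice L d) W P - sphase (lattice L d) P W)
        * (if smul W P \<in> X then q (smul W P) else 0))"
proof -
  have *: "smul P W = smul W P" by (simp add: smul_def pmul_comm)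
  have "(\<Sum>A\<in>X. q A * (c * (if smul W P = A then D else 0))) = c * D * (if smul W P \<in> X then q (smul W P) else 0)" for c D :: complex
  proof -
    have "(\<Sum>A\<in>X. q A * (c * (if smul W P = A then D else 0)))
      = (\<Sum>A\<in>X. if smul W P = A then q A * c * D else 0)"
      by (rule sum.cong) auto
    then show ?thesis using assms(1) by (simp add: sum.delta')
  qed
  note collapse = this
  have "opair L d (product_op L d W) (\<lambda>\<sigma> \<tau>. \<Sum>A\<in>X. q A * product_op L d A \<sigma> \<tau>) (product_op L d P)
    = (\<Sum>A\<in>X. q A * (sphase (lattice L d) W P * (if smul W P = A then 2 ^ card (lattice L d) else 0)))
    - (\<Sum>A\<in>X. q A * (sphase (lattice L d) P W * (if smul W P = A then 2 ^ card (lattice L d) else 0)))"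
    using assms by (simp add: opair_alt op_mult_sum_right optrace_sum optrace_product3 * cong: sum.cong)
  then show ?thesis unfolding collapse by (simp add: algebra_simps)
qed

lemma opair_sum:
  "opair L d W Q (\<lambda>\<sigma> \<tau>. \<Sum>x\<in>X. c x * B x \<sigma> \<tau>) = (\<Sum>x\<in>X. c x * opair L d W Q (B x))"
proof -
  have 1: "commutator L d (\<lambda>\<sigma> \<tau>. \<Sum>x\<in>X. c x * B x \<sigma> \<tau>) Q \<sigma> \<tau> = (\<Sum>x\<in>X. c x * commutator L d (B x) Q \<sigma> \<tau>)" for \<sigma> \<tau>
    unfolding commutator_def op_mult_def sum_distrib_left sum_distrib_right right_diff_distrib sum_subtractf
    by (subst sum.swap, subst (2) sum.swap) (simp add: mult_ac)
  show ?thesis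
    unfolding opair_def 1 sum_distrib_left
    by (subst (2) sum.swap, subst sum.swap) (simp add: mult_ac)
qed

lemma opair_add:
  "opair L d W Q (\<lambda>\<sigma> \<tau>. a * A \<sigma> \<tau> + b * B \<sigma> \<tau>) = a * opair L d W Q A + b * opair L d W Q B"
  by (simp add: opair_def commutator_def op_mult_def algebra_simps sum.distrib sum_subtractf sum_distrib_left)


section \<open>The Hamiltonian as a combination of Pauli strings, and the linear relations\<close>

definition nbr_pairs :: "nat \<Rightarrow> nat \<Rightarrow> (site \<times> site) set" where
  "nbr_pairs L d = {(u, v). u \<in> lattice L d \<and> v \<in> lattice L d \<and> nearest_nbr L d u v}"

lemma finite_nbr_pairs [simp]: "finite (nbr_pairs L d)"
  by (rule finite_subset [of _ "lattice L d \<times> lattice L d"]) (auto simp: nbr_pairs_def)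

lemma nbr_pairs_irrefl:
  assumes "L \<ge> 2" shows "(u, u) \<notin> nbr_pairs L d"
proof -
  have "\<not> int L dvd 1" "\<not> int L dvd -1" using assms by (auto simp: zdvd1_eq)
  then show ?thesis
    by (auto simp: nbr_pairs_def nearest_nbr_def cong_iff_dvd_diff)
qed

lemma site_pauli_eq: "site_pauli L d t u = product_op L d [u \<mapsto> t]"
  unfolding site_pauli_def product_op_def
  by (rule arg_cong [where f = "tensor L d"]) auto

lemma bond_op:
  assumes "u \<noteq> v"
  shows "op_mult L d (site_pauli L d t u) (site_pauli L d t v) = product_op L d (bond u v t)"
  unfolding site_pauli_def product_op_def tensor_mult
  by (rule arg_cong [where f = "tensor L d"]) (use assms in \<open>auto simp: bond_def\<close>)

definition coupling :: "real \<Rightarrow> real \<Rightarrow> real \<Rightarrow> pauli \<Rightarrow> real" where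
  "coupling x y z t = (case t of PX \<Rightarrow> x | PY \<Rightarrow> y | PZ \<Rightarrow> z)"

text \<open>This is the shape to which linearity of \<open>opair\<close> applies. Neighbours are
  distinct sites because \<open>L \<ge> 2\<close>, so every coupling term is a two-site string; each
  bond occurs once per orientation.\<close>

lemma hamiltonian_eq:
  assumes "L \<ge> 2"
  shows "hamiltonian L d JX JY JZ hX hY hZ = (\<lambda>\<sigma> \<tau>.
     (- 1/2) * (\<Sum>((u, v), t)\<in>nbr_pairs L d \<times> UNIV.
          of_real (coupling JX JY JZ t) * product_op L d (bond u v t) \<sigma> \<tau>)
     + (- 1) * (\<Sum>(u, t)\<in>lattice L d \<times> UNIV.
          of_real (coupling hX hY hZ t) * product_op L d [u \<mapsto> t] \<sigma> \<tau>))"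
proof (intro ext)
  fix \<sigma> \<tau>
  have 1: "(\<Sum>((u, v), t)\<in>nbr_pairs L d \<times> UNIV.
          of_real (coupling JX JY JZ t) * product_op L d (bond u v t) \<sigma> \<tau>)
    = (\<Sum>(u, v) | u \<in> lattice L d \<and> v \<in> lattice L d \<and> nearest_nbr L d u v.
          of_real JX * op_mult L d (site_pauli L d PX u) (site_pauli L d PX v) \<sigma> \<tau>
        + of_real JY * op_mult L d (site_pauli L d PY u) (site_pauli L d PY v) \<sigma> \<tau>
        + of_real JZ * op_mult L d (site_pauli L d PZ u) (site_pauli L d PZ v) \<sigma> \<tau>)"
    unfolding nbr_pairs_def [symmetric]
    unfolding sum.cartesian_product [symmetric]
  proof (rule sum.cong [OF refl], clarify)
    fix u v assume "(u, v) \<in> nbr_pairs L d"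
    then have "u \<noteq> v" using nbr_pairs_irrefl [OF assms] by auto
    then show "(\<Sum>t\<in>UNIV. of_real (coupling JX JY JZ t) * product_op L d (bond u v t) \<sigma> \<tau>)
      = of_real JX * op_mult L d (site_pauli L d PX u) (site_pauli L d PX v) \<sigma> \<tau>
        + of_real JY * op_mult L d (site_pauli L d PY u) (site_pauli L d PY v) \<sigma> \<tau>
        + of_real JZ * op_mult L d (site_pauli L d PZ u) (site_pauli L d PZ v) \<sigma> \<tau>"
      by (simp add: bond_op UNIV_pauli coupling_def)
  qed
  show "hamiltonian L d JX JY JZ hX hY hZ \<sigma> \<tau> =
     (- 1/2) * (\<Sum>((u, v), t)\<in>nbr_pairs L d \<times> UNIV.
          of_real (coupling JX JY JZ t) * product_op L d (bond u v t) \<sigma> \<tau>)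
     + (- 1) * (\<Sum>(u, t)\<in>lattice L d \<times> UNIV.
          of_real (coupling hX hY hZ t) * product_op L d [u \<mapsto> t] \<sigma> \<tau>)"
    unfolding hamiltonian_def 1
    by (simp add: site_pauli_eq sum.cartesian_product [symmetric] UNIV_pauli coupling_def add.assoc)
qed


text \<open>The contribution of the summand \<open>P\<close> to the trace of
  \<open>W [H, Q]\<close>, up to its prefactor in \<open>H\<close> and a common power of 2.\<close>

definition pauli_comm :: "site set \<Rightarrow> ((site \<rightharpoonup> pauli) \<Rightarrow> complex) \<Rightarrow> (site \<rightharpoonup> pauli) \<Rightarrow> (site \<rightharpoonup> pauli) \<Rightarrow> complex" where
  "pauli_comm \<Lambda> q W P = (sphase \<Lambda> W P - sphase \<Lambda> P W) * q (smul W P)"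

text \<open>The trace of \<open>W [H, Q]\<close> vanishes, and dividing it by \<open>- N / 2\<close>
  leaves weight 1 on the bonds and 2 on the fields. Replacing \<open>q\<close> by its extension by
  zero \<open>q'\<close> turns the restriction on the strings in \<open>Q\<close> into vanishing of
  coefficients.\<close>

lemma conserved_relation:
  assumes "L \<ge> 2"
    and Q: "op_eq L d Q (\<lambda>\<sigma> \<tau>. \<Sum>A\<in>X. q A * product_op L d A \<sigma> \<tau>)"
    and comm: "op_eq L d (commutator L d (hamiltonian L d JX JY JZ hX hY hZ) Q) (\<lambda>\<sigma> \<tau>. 0)"
    and X: "finite X" "\<And>A. A \<in> X \<Longrightarrow> dom A \<subseteq> lattice L d"
    and W: "dom W \<subseteq> lattice L d"
    and q': "\<And>A. q' A = (if A \<in> X then q A else 0)"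
  shows "(\<Sum>((u, v), t)\<in>nbr_pairs L d \<times> UNIV.
          of_real (coupling JX JY JZ t) * pauli_comm (lattice L d) q' W (bond u v t))
     + 2 * (\<Sum>(u, t)\<in>lattice L d \<times> UNIV.
          of_real (coupling hX hY hZ t) * pauli_comm (lattice L d) q' W [u \<mapsto> t]) = 0"
    (is "?a + 2 * ?b = 0")
proof -
  define Q' where "Q' = (\<lambda>\<sigma> \<tau>. \<Sum>A\<in>X. q A * product_op L d A \<sigma> \<tau>)"
  define N :: complex where "N = 2 ^ card (lattice L d)"
  have "N \<noteq> 0" by (simp add: N_def)
  let ?W = "product_op L d W"
  have val: "opair L d ?W Q' (product_op L d P) = N * pauli_comm (lattice L d) q' W P"
    if "dom P \<subseteq> lattice L d" for P
    unfolding Q'_def N_def pauli_comm_def q' by (rule opair_product) (use X W that in auto)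
  have "opair L d ?W Q' (hamiltonian L d JX JY JZ hX hY hZ) = 0"
    using comm commutator_cong_right [OF Q [folded Q'_def]] unfolding opair_def op_eq_def by simp
  then have "0 = (- 1/2) * (\<Sum>((u, v), t)\<in>nbr_pairs L d \<times> UNIV.
          of_real (coupling JX JY JZ t) * opair L d ?W Q' (product_op L d (bond u v t)))
     + (- 1) * (\<Sum>(u, t)\<in>lattice L d \<times> UNIV.
          of_real (coupling hX hY hZ t) * opair L d ?W Q' (product_op L d [u \<mapsto> t]))"
    unfolding hamiltonian_eq [OF assms(1)] opair_add case_prod_unfold opair_sum by simp
  also have "(\<Sum>((u, v), t)\<in>nbr_pairs L d \<times> UNIV.
          of_real (coupling JX JY JZ t) * opair L d ?W Q' (product_op L d (bond u v t)))
    = N * (\<Sum>((u, v), t)\<in>nbr_pairs L d \<times> UNIV.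
          of_real (coupling JX JY JZ t) * pauli_comm (lattice L d) q' W (bond u v t))"
    unfolding sum_distrib_left
  proof (rule sum.cong [OF refl], safe)
    fix u v t assume "(u, v) \<in> nbr_pairs L d"
    then have "dom (bond u v t) \<subseteq> lattice L d"
      by (auto simp: nbr_pairs_def bond_def split: if_splits)
    then show "of_real (coupling JX JY JZ t) * opair L d ?W Q' (product_op L d (bond u v t))
      = N * (of_real (coupling JX JY JZ t) * pauli_comm (lattice L d) q' W (bond u v t))"
      by (simp add: val)
  qed
  also have "(\<Sum>(u, t)\<in>lattice L d \<times> UNIV.
          of_real (coupling hX hY hZ t) * opair L d ?W Q' (product_op L d [u \<mapsto> t]))
    = N * (\<Sum>(u, t)\<in>lattice L d \<times> UNIV.
          of_real (coupling hX hY hZ t) * pauli_comm (lattice L d) q' W [u \<mapsto> t])"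
    unfolding sum_distrib_left by (rule sum.cong [OF refl]) (auto simp: val)
  finally have "N * (?a + 2 * ?b) = 0"
    by (simp add: algebra_simps del: mult_eq_0_iff)
  then show ?thesis using \<open>N \<noteq> 0\<close> by simp
qed

section \<open>Layers of the periodic lattice\<close>

definition layer :: "nat \<Rightarrow> int \<Rightarrow> nat \<Rightarrow> site \<Rightarrow> int" where
  "layer L a \<alpha> u = (u \<alpha> - a) mod int L"

text \<open>The bound is an integer so that \<open>int k - 1\<close> can be used directly, and the
  origin \<open>a\<close> is an arbitrary integer, while \<open>width_dir\<close> confines it to one
  period.\<close>

definition fits :: "nat \<Rightarrow> nat \<Rightarrow> int \<Rightarrow> site set \<Rightarrow> bool" where
  "fits L \<alpha> n S \<longleftrightarrow> (\<exists>a. \<forall>u\<in>S. layer L a \<alpha> u < n)"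

text \<open>Translation along the cycle. Coordinates run from 1 rather than 0, hence the shift by 1
  before and after \<open>mod\<close>.\<close>

definition move :: "nat \<Rightarrow> nat \<Rightarrow> int \<Rightarrow> site \<Rightarrow> site" where
  "move L \<alpha> n u = u(\<alpha> := (u \<alpha> - 1 + n) mod int L + 1)"

lemma layer_bounds: "L > 0 \<Longrightarrow> 0 \<le> layer L a \<alpha> u \<and> layer L a \<alpha> u < int L"
  by (simp add: layer_def)

lemma layer_move: "layer L a \<alpha> (move L \<alpha> n u) = (layer L a \<alpha> u + n) mod int L"
proof -
  have "((u \<alpha> - 1 + n) mod int L + 1 - a) mod int L = (u \<alpha> - 1 + n + 1 - a) mod int L"
    by (metis mod_add_left_eq mod_diff_left_eq)
  then show ?thesis
    by (simp add: layer_def move_def mod_add_left_eq) (simp add: algebra_simps)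
qed

lemma layer_move_other: "\<beta> \<noteq> \<alpha> \<Longrightarrow> layer L a \<beta> (move L \<alpha> n u) = layer L a \<beta> u"
  by (simp add: layer_def move_def)

lemma layer_shift: "layer L (a + b) \<alpha> u = (layer L a \<alpha> u - b) mod int L"
  by (simp add: layer_def mod_diff_left_eq diff_diff_eq)

lemma lattice_coord: "u \<in> lattice L d \<Longrightarrow> \<alpha> \<in> {1..d} \<Longrightarrow> 1 \<le> u \<alpha> \<and> u \<alpha> \<le> int L"
  by (auto simp: lattice_def PiE_def Pi_def)

lemma move_in_lattice:
  assumes "u \<in> lattice L d" "\<alpha> \<in> {1..d}"
  shows "move L \<alpha> n u \<in> lattice L d"
proof -
  have "L > 0" using lattice_coord [OF assms] by linarith
  then have "(u \<alpha> - 1 + n) mod int L + 1 \<in> {1..int L}"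
    using pos_mod_bound [of "int L" "u \<alpha> - 1 + n"] pos_mod_sign [of "int L" "u \<alpha> - 1 + n"]
    unfolding atLeastAtMost_iff by linarith
  then show ?thesis
    using assms unfolding lattice_def move_def
    by (auto simp: PiE_def Pi_def extensional_def)
qed

lemma move_0: "u \<in> lattice L d \<Longrightarrow> \<alpha> \<in> {1..d} \<Longrightarrow> move L \<alpha> 0 u = u"
  using lattice_coord [of u L d \<alpha>] by (simp add: move_def)

lemma move_move: "move L \<alpha> m (move L \<alpha> n u) = move L \<alpha> (m + n) u"
  using mod_add_left_eq [of "u \<alpha> - 1 + n" "int L" m] by (simp add: move_def algebra_simps)

lemma lattice_eqI:
  assumes "u \<in> lattice L d" "v \<in> lattice L d" "\<alpha> \<in> {1..d}"
    and "layer L a \<alpha> u = layer L a \<alpha> v" "\<And>\<beta>. \<beta> \<in> {1..d} \<Longrightarrow> \<beta> \<noteq> \<alpha> \<Longrightarrow> u \<beta> = v \<beta>"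
  shows "u = v"
proof -
  have "int L dvd u \<alpha> - v \<alpha>"
    using assms(4) by (simp add: layer_def mod_eq_dvd_iff)
  then have "u \<alpha> = v \<alpha>"
    using lattice_coord [OF assms(1,3)] lattice_coord [OF assms(2,3)]
      zdvd_not_zless [of "u \<alpha> - v \<alpha>" "int L"] zdvd_not_zless [of "v \<alpha> - u \<alpha>" "int L"]
      dvd_diff_commute [of "int L" "u \<alpha>" "v \<alpha>"] by linarith
  then have "u \<beta> = v \<beta>" if "\<beta> \<in> {1..d}" for \<beta> using that assms(5) by (cases "\<beta> = \<alpha>") auto
  then show ?thesis using assms(1,2) unfolding lattice_def by (metis PiE_ext)
qed

lemma nbr_pairs_iff:
  "(u, v) \<in> nbr_pairs L d \<longleftrightarrow>
     u \<in> lattice L d \<and> (\<exists>\<alpha>\<in>{1..d}. v = move L \<alpha> 1 u \<or> v = move L \<alpha> (- 1) u)"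
proof
  assume "(u, v) \<in> nbr_pairs L d"
  then obtain \<alpha> where uv: "u \<in> lattice L d" "v \<in> lattice L d" and \<alpha>: "\<alpha> \<in> {1..d}"
    and dif: "[u \<alpha> - v \<alpha> = 1] (mod int L) \<or> [u \<alpha> - v \<alpha> = - 1] (mod int L)"
    and oth: "\<forall>\<beta>\<in>{1..d} - {\<alpha>}. u \<beta> = v \<beta>"
    unfolding nbr_pairs_def nearest_nbr_def by auto
  have *: "v = move L \<alpha> (- c) u" if "[u \<alpha> - v \<alpha> = c] (mod int L)" for c
  proof (rule lattice_eqI [OF uv(2) move_in_lattice [OF uv(1) \<alpha>] \<alpha>])
    have "[u \<alpha> - (u \<alpha> - v \<alpha>) = u \<alpha> - c] (mod int L)" using that cong_diff cong_refl by blast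
    then show "layer L 0 \<alpha> v = layer L 0 \<alpha> (move L \<alpha> (- c) u)"
      unfolding layer_move by (simp add: layer_def cong_def mod_simps)
    show "v \<beta> = move L \<alpha> (- c) u \<beta>" if "\<beta> \<in> {1..d}" "\<beta> \<noteq> \<alpha>" for \<beta>
      using oth that by (simp add: move_def)
  qed
  show "u \<in> lattice L d \<and> (\<exists>\<alpha>\<in>{1..d}. v = move L \<alpha> 1 u \<or> v = move L \<alpha> (- 1) u)"
    using dif * [of 1] * [of "- 1"] uv(1) \<alpha> by auto
next
  have *: "[u \<alpha> - move L \<alpha> c u \<alpha> = - c] (mod int L)" for c \<alpha>
  proof -
    have "[move L \<alpha> c u \<alpha> = u \<alpha> + c] (mod int L)"
      using layer_move [of L 0 \<alpha> c u] by (simp add: layer_def cong_def mod_simps)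
    then have "[u \<alpha> - move L \<alpha> c u \<alpha> = u \<alpha> - (u \<alpha> + c)] (mod int L)"
      by (intro cong_diff cong_refl)
    then show ?thesis by simp
  qed
  assume "u \<in> lattice L d \<and> (\<exists>\<alpha>\<in>{1..d}. v = move L \<alpha> 1 u \<or> v = move L \<alpha> (- 1) u)"
  then obtain \<alpha> c where u: "u \<in> lattice L d" and \<alpha>: "\<alpha> \<in> {1..d}" and v: "v = move L \<alpha> c u"
    and c: "c = 1 \<or> c = - 1" by blast
  have "[u \<alpha> - v \<alpha> = 1] (mod int L) \<or> [u \<alpha> - v \<alpha> = - 1] (mod int L)"
    using * [of \<alpha> c] c unfolding v by auto
  moreover have "\<forall>\<beta>\<in>{1..d} - {\<alpha>}. u \<beta> = v \<beta>" by (simp add: v move_def)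
  ultimately show "(u, v) \<in> nbr_pairs L d"
    using u \<alpha> move_in_lattice [OF u \<alpha>, of c] unfolding nbr_pairs_def nearest_nbr_def v by blast
qed

lemma nbr_pairs_lattice: "(u, v) \<in> nbr_pairs L d \<Longrightarrow> u \<in> lattice L d \<and> v \<in> lattice L d"
  by (simp add: nbr_pairs_def)

lemma nbr_pairs_sym:
  assumes "(u, v) \<in> nbr_pairs L d" shows "(v, u) \<in> nbr_pairs L d"
proof -
  have inl: "u \<in> lattice L d" "v \<in> lattice L d"
    using assms nbr_pairs_lattice by auto
  obtain \<alpha> where \<alpha>: "\<alpha> \<in> {1..d}" and "v = move L \<alpha> 1 u \<or> v = move L \<alpha> (- 1) u"
    using assms unfolding nbr_pairs_iff by blast
  then have "u = move L \<alpha> (- 1) v \<or> u = move L \<alpha> 1 v"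
    using move_0 [OF inl(1) \<alpha>] by (auto simp: move_move)
  then show ?thesis using \<alpha> inl unfolding nbr_pairs_iff by blast
qed

text \<open>Going round the cycle the other way takes \<open>L - n \<ge> n\<close> steps, so every
  window containing both sites has more than \<open>n\<close> layers. The condition
  \<open>2 * n \<le> int L\<close> will come from the bound of the width by half the period.\<close>

lemma not_fits:
  assumes "x \<in> S" "layer L a \<alpha> x = 0" "y \<in> S" "layer L a \<alpha> y = n" "0 \<le> n" "2 * n \<le> int L" "0 < L"
  shows "\<not> fits L \<alpha> n S"
proof
  assume "fits L \<alpha> n S"
  then obtain a' where "\<forall>u\<in>S. layer L a' \<alpha> u < n"
    unfolding fits_def by blast
  then have b: "\<forall>u\<in>S. layer L (a + (a' - a)) \<alpha> u < n" by simp
  \<comment> \<open>\<open>z\<close> is the layer of \<open>x\<close> in the supposed window. Then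
    \<open>y\<close> is in layer \<open>n + z\<close>, without wrap-around since
    \<open>n + z < 2 * n\<close>.\<close>
  define z where "z = (a - a') mod int L"
  have z: "0 \<le> z" "z < n" "(n + z) mod int L < n"
  proof -
    show "0 \<le> z" using assms(7) by (simp add: z_def)
    show "z < n" using bspec [OF b assms(1)] unfolding layer_shift assms(2) by (simp add: z_def)
    show "(n + z) mod int L < n"
      using bspec [OF b assms(3)] unfolding layer_shift assms(4)
      by (simp add: z_def mod_simps algebra_simps)
  qed
  have "(n + z) mod int L = n + z" using z assms(5,6) by (intro mod_pos_pos_trivial) auto
  with z show False by simp
qed


section \<open>Commutation of strings with bonds and single-site terms\<close>

definition anticomm :: "pauli option \<Rightarrow> pauli \<Rightarrow> bool" where
  "anticomm a t \<longleftrightarrow> a \<noteq> None \<and> a \<noteq> Some t"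

lemma phase_swap: "phase (Some t) a = (if anticomm a t then - phase a (Some t) else phase a (Some t))"
  by (cases t; cases a rule: option_pauli_cases) (simp_all add: anticomm_def)

lemma phase_nonzero [simp]: "phase a b \<noteq> 0"
  by (cases a rule: option_pauli_cases; cases b rule: option_pauli_cases) simp_all

lemma pmul_eq_None: "pmul a (Some t) = None \<longleftrightarrow> a = Some t"
  by (cases t; cases a rule: option_pauli_cases) simp_all

lemma bond_commute: "bond u v t = bond v u t"
  by (auto simp: bond_def)

lemma smul_cancel [simp]: "smul (smul A B) B = A"
  by (simp add: smul_def pmul_cancel)

lemma smul_commute: "smul A B = smul B A"
  by (simp add: smul_def pmul_comm)

lemma smul_assoc: "smul (smul A B) C = smul A (smul B C)"
  by (simp add: smul_def pmul_assoc)

lemma sphase_nonzero: "sphase \<Lambda> A B \<noteq> 0"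
  by (cases "finite \<Lambda>") (simp_all add: sphase_def prod_zero_iff)

lemma sphase_bond:
  assumes "u \<in> \<Lambda>" "v \<in> \<Lambda>" "u \<noteq> v" "finite \<Lambda>"
  shows "sphase \<Lambda> A (bond u v t) = phase (A u) (Some t) * phase (A v) (Some t)"
    and "sphase \<Lambda> (bond u v t) A = phase (Some t) (A u) * phase (Some t) (A v)"
proof -
  have "sphase \<Lambda> A (bond u v t) = (\<Prod>w\<in>{u, v}. phase (A w) (bond u v t w))"
    unfolding sphase_def by (rule prod.mono_neutral_right) (use assms in \<open>auto simp: bond_def\<close>)
  then show "sphase \<Lambda> A (bond u v t) = phase (A u) (Some t) * phase (A v) (Some t)"
    using assms by (simp add: bond_def)
  have "sphase \<Lambda> (bond u v t) A = (\<Prod>w\<in>{u, v}. phase (bond u v t w) (A w))"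
    unfolding sphase_def by (rule prod.mono_neutral_right) (use assms in \<open>auto simp: bond_def\<close>)
  then show "sphase \<Lambda> (bond u v t) A = phase (Some t) (A u) * phase (Some t) (A v)"
    using assms by (simp add: bond_def)
qed

lemma sphase_single:
  assumes "u \<in> \<Lambda>" "finite \<Lambda>"
  shows "sphase \<Lambda> A [u \<mapsto> t] = phase (A u) (Some t)"
    and "sphase \<Lambda> [u \<mapsto> t] A = phase (Some t) (A u)"
proof -
  have "sphase \<Lambda> A [u \<mapsto> t] = (\<Prod>w\<in>{u}. phase (A w) ([u \<mapsto> t] w))"
    unfolding sphase_def by (rule prod.mono_neutral_right) (use assms in auto)
  then show "sphase \<Lambda> A [u \<mapsto> t] = phase (A u) (Some t)" by simp
  have "sphase \<Lambda> [u \<mapsto> t] A = (\<Prod>w\<in>{u}. phase ([u \<mapsto> t] w) (A w))"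
    unfolding sphase_def by (rule prod.mono_neutral_right) (use assms in auto)
  then show "sphase \<Lambda> [u \<mapsto> t] A = phase (Some t) (A u)" by simp
qed

text \<open>Each end at which the matrices anticommute contributes a sign, and two signs cancel; a
  bond therefore counts only if exactly one end anticommutes.\<close>

lemma pauli_comm_bond:
  assumes "u \<in> \<Lambda>" "v \<in> \<Lambda>" "u \<noteq> v" "finite \<Lambda>"
  shows "pauli_comm \<Lambda> q W (bond u v t) =
    (if anticomm (W u) t \<noteq> anticomm (W v) t
     then 2 * (phase (W u) (Some t) * phase (W v) (Some t)) * q (smul W (bond u v t)) else 0)"
  unfolding pauli_comm_def sphase_bond [OF assms] by (auto simp: phase_swap)

lemma pauli_comm_single:
  assumes "u \<in> \<Lambda>" "finite \<Lambda>"
  shows "pauli_comm \<Lambda> q W [u \<mapsto> t] =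
    (if anticomm (W u) t then 2 * phase (W u) (Some t) * q (smul W [u \<mapsto> t]) else 0)"
  unfolding pauli_comm_def sphase_single [OF assms] by (auto simp: phase_swap)

lemma sphase_cocycle:
  "sphase \<Lambda> A B * sphase \<Lambda> (smul A B) C = sphase \<Lambda> B C * sphase \<Lambda> A (smul B C)"
  unfolding sphase_def smul_def prod.distrib [symmetric] phase_cocycle ..

section \<open>Which terms of the Hamiltonian can erase a site\<close>

inductive ham_term :: "nat \<Rightarrow> nat \<Rightarrow> (site \<rightharpoonup> pauli) \<Rightarrow> bool" for L d where
  "(u, v) \<in> nbr_pairs L d \<Longrightarrow> ham_term L d (bond u v t)"
| "u \<in> lattice L d \<Longrightarrow> ham_term L d [u \<mapsto> t]"

text \<open>Erasing \<open>x\<close> needs the same matrix at \<open>x\<close>, and equal matrices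
  commute. The sign must then come from a second site \<open>y\<close>, where \<open>W\<close> is
  occupied by a different matrix and is not cancelled. This excludes single-site terms and shows
  that one term erases at most one site.\<close>

lemma term_removal:
  assumes P: "ham_term L d P" and c: "pauli_comm (lattice L d) q W P \<noteq> 0" and L: "L \<ge> 2"
    and x: "W x \<noteq> None" "smul W P x = None"
  obtains y t where "(x, y) \<in> nbr_pairs L d" "P = bond x y t" "W x = Some t" "anticomm (W y) t"
    "\<And>z. W z \<noteq> None \<Longrightarrow> z \<noteq> x \<Longrightarrow> smul W P z \<noteq> None"
  using P
proof cases
  case (1 u v t)
  note uv = 1
  have ne: "u \<noteq> v" "v \<noteq> u" and inl: "u \<in> lattice L d" "v \<in> lattice L d"
    using nbr_pairs_irrefl [OF L] uv(2) by (auto simp: nbr_pairs_def)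
  have vu: "(v, u) \<in> nbr_pairs L d" using uv(2) by (rule nbr_pairs_sym)
  have ac: "anticomm (W u) t \<noteq> anticomm (W v) t"
    using c unfolding uv(1) pauli_comm_bond [OF inl ne(1) finite_lattice] by (auto split: if_splits)
  have sm: "smul W P z = (if z = u \<or> z = v then pmul (W z) (Some t) else W z)" for z
    by (simp add: uv(1) smul_def bond_def)
  have xt: "(x = u \<or> x = v) \<and> W x = Some t"
    using x by (auto simp: sm pmul_eq_None split: if_splits)
  show thesis
  proof (cases "x = u")
    case True
    with xt ac have "anticomm (W v) t" by (simp add: anticomm_def)
    moreover from this have "smul W P z \<noteq> None" if "W z \<noteq> None" "z \<noteq> x" for z
      using that True by (auto simp: sm pmul_eq_None anticomm_def split: if_splits)
    ultimately show thesis using True xt uv by (intro that [of v t]) auto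
  next
    case False
    with xt ac have "anticomm (W u) t" "x = v" by (auto simp: anticomm_def)
    moreover from this have "smul W P z \<noteq> None" if "W z \<noteq> None" "z \<noteq> x" for z
      using that by (auto simp: sm pmul_eq_None anticomm_def split: if_splits)
    ultimately show thesis using xt uv vu by (intro that [of u t]) (auto simp: bond_commute)
  qed
next
  case (2 u t)
  then have "anticomm (W u) t"
    using c by (auto simp: pauli_comm_single split: if_splits)
  then show thesis
    using x by (auto simp: 2 smul_def anticomm_def pmul_eq_None split: if_splits)
qed

text \<open>Here \<open>m\<close> is an extreme layer and \<open>e\<close> points inwards. The
  second site of the erasing bond stays occupied, so it lies outside layer \<open>m\<close>; it
  cannot lie on the outer side, where \<open>W\<close> is empty. Any further site of layer
  \<open>m\<close> would survive, so \<open>x\<close> is alone.\<close>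

lemma end_removal:
  assumes P: "ham_term L d P" and c: "pauli_comm (lattice L d) q W P \<noteq> 0" and L: "L \<ge> 2"
    and \<alpha>: "\<alpha> \<in> {1..d}" and e: "e = 1 \<or> e = - 1"
    and x: "W x \<noteq> None" "layer L a \<alpha> x = m"
    and none: "\<And>y. smul W P y \<noteq> None \<Longrightarrow> layer L a \<alpha> y \<noteq> m"
    and out: "\<And>y. W y \<noteq> None \<Longrightarrow> layer L a \<alpha> y \<noteq> (m - e) mod int L"
  obtains t where "P = bond x (move L \<alpha> e x) t" "W x = Some t" "anticomm (W (move L \<alpha> e x)) t"
    "\<And>z. W z \<noteq> None \<Longrightarrow> layer L a \<alpha> z = m \<Longrightarrow> z = x"
proof -
  have "smul W P x = None" using none x by blast
  from term_removal [OF P c L x(1) this] obtain y t where y: "(x, y) \<in> nbr_pairs L d"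
    "P = bond x y t" "W x = Some t" "anticomm (W y) t"
    and keep: "\<And>z. W z \<noteq> None \<Longrightarrow> z \<noteq> x \<Longrightarrow> smul W P z \<noteq> None" by blast
  have "y \<noteq> x" using y(1) nbr_pairs_irrefl [OF L] by blast
  have Wy: "W y \<noteq> None" using y(4) by (simp add: anticomm_def)
  then have ly: "layer L a \<alpha> y \<noteq> m" using keep \<open>y \<noteq> x\<close> none by blast
  obtain \<beta> s where \<beta>: "\<beta> \<in> {1..d}" and ys: "y = move L \<beta> s x" and s: "s = 1 \<or> s = - 1"
    using y(1) unfolding nbr_pairs_iff by blast
  have "\<beta> = \<alpha>" using ly x(2) layer_move_other [of \<alpha> \<beta>] ys by metis
  moreover have "s = e"
  proof (rule ccontr)
    assume "s \<noteq> e"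
    then have "s = - e" using s e by auto
    then have "layer L a \<alpha> y = (m - e) mod int L" using ys x(2) \<open>\<beta> = \<alpha>\<close> by (simp add: layer_move)
    with out [OF Wy] show False by simp
  qed
  ultimately show thesis using that y(2-4) ys keep none by blast
qed

section \<open>Shifting strings of maximal width\<close>

lemma dom_bond: "dom (bond u v t) = {u, v}"
  by (auto simp: bond_def split: if_splits)

lemma bond_eqD:
  assumes "bond u v t = bond u' v' t'"
  shows "{u, v} = {u', v'}" "t = t'"
proof -
  show "{u, v} = {u', v'}" using arg_cong [OF assms, of dom] by (simp add: dom_bond)
  show "t = t'" using fun_cong [OF assms, of u] by (simp add: bond_def split: if_splits)
qed

lemma pmul_eq_Some: "pmul a (Some t) = Some t \<longleftrightarrow> a = None"
  by (cases t; cases a rule: option_pauli_cases) simp_all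

text \<open>The situation once the traces have been taken: only coefficients and their linear
  relations are left, with the width bound expressed through \<open>fits\<close>.\<close>

locale conserved =
  fixes L d k :: nat and J h :: "pauli \<Rightarrow> real" and q :: "(site \<rightharpoonup> pauli) \<Rightarrow> complex"
  assumes k3: "3 \<le> k" and kL: "2 * k \<le> L"
    and JX: "J PX \<noteq> 0" and JY: "J PY \<noteq> 0"
    and q_dom: "q A \<noteq> 0 \<Longrightarrow> dom A \<subseteq> lattice L d"
    and q_fits: "q A \<noteq> 0 \<Longrightarrow> \<alpha> \<in> {1..d} \<Longrightarrow> fits L \<alpha> (int k) (dom A)"
    and relation: "dom W \<subseteq> lattice L d \<Longrightarrow>
       (\<Sum>((u, v), t)\<in>nbr_pairs L d \<times> UNIV.
          of_real (J t) * pauli_comm (lattice L d) q W (bond u v t))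
     + 2 * (\<Sum>(u, t)\<in>lattice L d \<times> UNIV.
          of_real (h t) * pauli_comm (lattice L d) q W [u \<mapsto> t]) = 0"
begin

abbreviation "\<kappa> \<equiv> pauli_comm (lattice L d) q"

lemma L2: "L \<ge> 2" using k3 kL by simp

lemma nbr_ne: "(u, v) \<in> nbr_pairs L d \<Longrightarrow> u \<noteq> v"
  using nbr_pairs_irrefl [OF L2] by auto

lemma bond_sum:
  assumes W: "dom W \<subseteq> lattice L d" and B: "B \<subseteq> nbr_pairs L d \<times> UNIV"
    and anti: "\<And>u v t. ((u, v), t) \<in> B \<Longrightarrow> ((v, u), t) \<notin> B"
    and bonds: "\<And>u v t. (u, v) \<in> nbr_pairs L d \<Longrightarrow> J t \<noteq> 0 \<Longrightarrow> \<kappa> W (bond u v t) \<noteq> 0 \<Longrightarrow>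
      ((u, v), t) \<in> B \<or> ((v, u), t) \<in> B"
    and fields: "\<And>u t. u \<in> lattice L d \<Longrightarrow> \<kappa> W [u \<mapsto> t] = 0"
  shows "(\<Sum>((u, v), t)\<in>B. of_real (J t) * \<kappa> W (bond u v t)) = 0"
proof -
  let ?f = "\<lambda>((u, v), t). of_real (J t) * \<kappa> W (bond u v t)"
  let ?r = "\<lambda>((u, v), t). ((v, u), t :: pauli)"
  have fin: "finite (nbr_pairs L d \<times> (UNIV :: pauli set))" by simp
  have finB: "finite B" using B fin finite_subset by blast
  have inj: "inj_on ?r B" by (auto simp: inj_on_def)
  have disj: "B \<inter> ?r ` B = {}" using anti by auto
  have sub: "B \<union> ?r ` B \<subseteq> nbr_pairs L d \<times> UNIV" using B nbr_pairs_sym by auto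
  have "(\<Sum>x\<in>lattice L d \<times> UNIV. case x of (u, t) \<Rightarrow> of_real (h t) * \<kappa> W [u \<mapsto> t]) = 0"
    by (rule sum.neutral) (use fields in auto)
  then have "0 = sum ?f (nbr_pairs L d \<times> UNIV)" using relation [OF W] by simp
  also have "\<dots> = sum ?f (B \<union> ?r ` B)"
  proof (rule sum.mono_neutral_right [OF fin sub], rule ballI)
    fix x assume x: "x \<in> nbr_pairs L d \<times> UNIV - (B \<union> ?r ` B)"
    obtain u v t where xe: "x = ((u, v), t)" by (metis surj_pair)
    have "((v, u), t) \<notin> B" using x unfolding xe by force
    with x bonds [of u v t] show "?f x = 0" unfolding xe by auto
  qed
  also have "\<dots> = sum ?f B + sum ?f (?r ` B)"
    by (rule sum.union_disjoint) (use finB disj in auto)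
  also have "sum ?f (?r ` B) = sum ?f B"
    by (subst sum.reindex [OF inj]) (auto intro!: sum.cong simp: bond_commute)
  finally show ?thesis by simp
qed

text \<open>A relation cannot consist of one nonzero term. The coupling of the second term is
  recorded only for distinct ends, since \<open>bond x x s\<close> is a single-site string and
  belongs to the fields.\<close>

lemma other_term:
  assumes W: "dom W \<subseteq> lattice L d" and uv: "(u, v) \<in> nbr_pairs L d" and "J t \<noteq> 0"
    and "\<kappa> W (bond u v t) \<noteq> 0"
  obtains P where "ham_term L d P" "\<kappa> W P \<noteq> 0" "P \<noteq> bond u v t"
    "\<And>x y s. x \<noteq> y \<Longrightarrow> P = bond x y s \<Longrightarrow> J s \<noteq> 0"
proof (rule ccontr)
  note witness = that
  assume "\<not> thesis"
  have no: "False" if "ham_term L d P" "\<kappa> W P \<noteq> 0" "P \<noteq> bond u v t"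
    "\<And>x y s. x \<noteq> y \<Longrightarrow> P = bond x y s \<Longrightarrow> J s \<noteq> 0" for P
    by (rule notE [OF \<open>\<not> thesis\<close>], rule witness [OF that(1-3)], rule that(4))
  have "(\<Sum>((u, v), t)\<in>{((u, v), t)}. of_real (J t) * \<kappa> W (bond u v t)) = 0"
  proof (rule bond_sum [OF W])
    fix u' v' t' assume *: "(u', v') \<in> nbr_pairs L d" "J t' \<noteq> 0" "\<kappa> W (bond u' v' t') \<noteq> 0"
    have "J s \<noteq> 0" if "bond u' v' t' = bond x y s" for x y s
      using bond_eqD(2) [OF that] *(2) by simp
    then have "bond u' v' t' = bond u v t"
      using no [OF ham_term.intros(1) [OF *(1)] *(3)] by blast
    then show "((u', v'), t') \<in> {((u, v), t)} \<or> ((v', u'), t') \<in> {((u, v), t)}"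
      using bond_eqD [of u' v' t' u v t] by (auto simp: doubleton_eq_iff)
  next
    fix x s assume x: "x \<in> lattice L d"
    have ne: "[x \<mapsto> s] \<noteq> bond y z s'" if "y \<noteq> z" for y z s'
    proof
      assume "[x \<mapsto> s] = bond y z s'"
      from arg_cong [OF this, of dom] that show False by (auto simp: dom_bond)
    qed
    show "\<kappa> W [x \<mapsto> s] = 0"
      using no [OF ham_term.intros(2) [OF x, of s]] ne nbr_ne [OF uv] by blast
  qed (use uv nbr_ne in auto)
  with assms show False by simp
qed

text \<open>By \<open>not_fits\<close> a product of width at most \<open>n\<close> cannot occupy
  both layer 0 and layer \<open>n\<close>, so \<open>P\<close> empties one of them and
  \<open>end_removal\<close> applies. The case \<open>n = k\<close> serves lengthened strings, the
  case \<open>n = k - 1\<close> lines with an attached bond.\<close>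

lemma two_ends:
  assumes P: "ham_term L d P" "\<kappa> W P \<noteq> 0" and \<alpha>: "\<alpha> \<in> {1..d}"
    and W: "\<And>x. W x \<noteq> None \<Longrightarrow> layer L a \<alpha> x \<le> n"
    and x: "W x \<noteq> None" "layer L a \<alpha> x = 0"
    and y: "W y \<noteq> None" "layer L a \<alpha> y = n"
    and n: "0 \<le> n" "n \<le> int k" and fit: "fits L \<alpha> n (dom (smul W P))"
  obtains (left) t where "P = bond x (move L \<alpha> 1 x) t" "W x = Some t" "anticomm (W (move L \<alpha> 1 x)) t"
      "\<And>z. W z \<noteq> None \<Longrightarrow> layer L a \<alpha> z = 0 \<Longrightarrow> z = x"
    | (right) t where "P = bond y (move L \<alpha> (- 1) y) t" "W y = Some t" "anticomm (W (move L \<alpha> (- 1) y)) t"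
      "\<And>z. W z \<noteq> None \<Longrightarrow> layer L a \<alpha> z = n \<Longrightarrow> z = y"
proof -
  have nL: "2 * n \<le> int L" "0 < L" "n + 1 < int L" using n k3 kL by auto
  have "(\<forall>z. smul W P z \<noteq> None \<longrightarrow> layer L a \<alpha> z \<noteq> 0) \<or> (\<forall>z. smul W P z \<noteq> None \<longrightarrow> layer L a \<alpha> z \<noteq> n)"
    using not_fits [where S = "dom (smul W P)" and L = L and a = a and \<alpha> = \<alpha> and n = n, OF _ _ _ _ n(1) nL(1,2)] fit
    unfolding domIff by blast
  then show thesis
  proof
    assume none: "\<forall>z. smul W P z \<noteq> None \<longrightarrow> layer L a \<alpha> z \<noteq> 0"
    show thesis
    proof (rule end_removal [OF P L2 \<alpha>, where e = 1 and x = x and a = a and m = 0])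
      show "layer L a \<alpha> z \<noteq> (0 - 1) mod int L" if "W z \<noteq> None" for z
        using W [OF that] nL by (simp add: zmod_minus1)
      show "layer L a \<alpha> z \<noteq> 0" if "smul W P z \<noteq> None" for z using none that by blast
    qed (simp, fact x(1), fact x(2), rule left)
  next
    assume none: "\<forall>z. smul W P z \<noteq> None \<longrightarrow> layer L a \<alpha> z \<noteq> n"
    show thesis
    proof (rule end_removal [OF P L2 \<alpha>, where e = "- 1" and x = y and a = a and m = n])
      show "layer L a \<alpha> z \<noteq> (n - (- 1)) mod int L" if "W z \<noteq> None" for z
        using W [OF that] nL n(1) by simp
      show "layer L a \<alpha> z \<noteq> n" if "smul W P z \<noteq> None" for z using none that by blast
    qed (simp, fact y(1), fact y(2), rule right)
  qed
qed

text \<open>Both extreme layers are occupied, so that the width in direction \<open>\<alpha>\<close>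
  is exactly \<open>k\<close>.\<close>

definition span :: "nat \<Rightarrow> int \<Rightarrow> (site \<rightharpoonup> pauli) \<Rightarrow> bool" where
  "span \<alpha> a A \<longleftrightarrow> q A \<noteq> 0 \<and> \<alpha> \<in> {1..d} \<and> (\<forall>x. A x \<noteq> None \<longrightarrow> layer L a \<alpha> x < int k) \<and>
     (\<exists>x. A x \<noteq> None \<and> layer L a \<alpha> x = 0) \<and> (\<exists>x. A x \<noteq> None \<and> layer L a \<alpha> x = int k - 1)"

lemma J_nonzero: "t \<noteq> PZ \<Longrightarrow> J t \<noteq> 0"
  using JX JY by (cases t) auto

text \<open>A bond appended at the top site \<open>u\<close> gives a string of width
  \<open>k + 1\<close> whose relation contains \<open>q A\<close>. The term balancing it must
  shorten the string. At the top that would only undo the new bond, so it removes \<open>w\<close>,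
  and \<open>A\<close> has moved one layer forward. Since \<open>w\<close> is any site of layer 0,
  its uniqueness follows too.\<close>

lemma shift:
  assumes A: "span \<alpha> a A" and w: "A w \<noteq> None" "layer L a \<alpha> w = 0"
    and u: "A u \<noteq> None" "layer L a \<alpha> u = int k - 1" and t: "t \<noteq> PZ" "A u \<noteq> Some t"
  obtains s A' where "A w = Some s" "J s \<noteq> 0" "anticomm (A (move L \<alpha> 1 w)) s"
    "\<And>z. A z \<noteq> None \<Longrightarrow> layer L a \<alpha> z = 0 \<Longrightarrow> z = w"
    "A' = (\<lambda>z. if z = w then None else if z = move L \<alpha> 1 w then pmul (A z) (Some s)
       else if z = u then pmul (A u) (Some t) else if z = move L \<alpha> 1 u then Some t else A z)"
    "span \<alpha> (a + 1) A'"
proof -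
  have qA: "q A \<noteq> 0" and \<alpha>: "\<alpha> \<in> {1..d}" and Ak: "\<And>x. A x \<noteq> None \<Longrightarrow> layer L a \<alpha> x < int k"
    using A by (auto simp: span_def)
  have kk: "int k < int L" "int k \<ge> 3" "1 < int L" "2 * k \<le> L" using k3 kL by auto
  have domA: "dom A \<subseteq> lattice L d" using q_dom qA by blast
  then have wl: "w \<in> lattice L d" "u \<in> lattice L d" using w u by (auto simp: dom_def)
  let ?v = "move L \<alpha> 1 u" and ?m = "move L \<alpha> 1 w"
  have lv: "layer L a \<alpha> ?v = int k" and lm: "layer L a \<alpha> ?m = 1"
    using u w kk by (simp_all add: layer_move)
  have uv: "(u, ?v) \<in> nbr_pairs L d" using wl \<alpha> unfolding nbr_pairs_iff by blast
  \<comment> \<open>The inner sites \<open>?m\<close> and \<open>u\<close> lie in layers 1 and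
    \<open>k - 1\<close>, which differ because \<open>k \<ge> 3\<close>.\<close>
  have ne: "u \<noteq> ?v" "?m \<noteq> u" "?m \<noteq> ?v" "w \<noteq> u" "w \<noteq> ?v" "w \<noteq> ?m"
    using lv lm u w kk by auto
  have Av: "A ?v = None" using Ak lv by force
  define W where "W = smul A (bond u ?v t)"
  have Wz: "W z = (if z = u then pmul (A u) (Some t) else if z = ?v then Some t else A z)" for z
    using Av by (simp add: W_def smul_def bond_def)
  have vl: "?v \<in> lattice L d" using uv by (simp add: nbr_pairs_def)
  have Wl: "dom W \<subseteq> lattice L d"
    using domA wl vl by (auto simp: Wz dom_def split: if_splits)
  \<comment> \<open>Exactly one end anticommutes: at \<open>?v\<close> both matrices are
    \<open>t\<close>.\<close>
  have "anticomm (W u) t"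
    using u(1) t(2) by (simp add: Wz anticomm_def pmul_eq_None pmul_eq_Some)
  moreover have "\<not> anticomm (W ?v) t" using ne by (simp add: Wz anticomm_def)
  ultimately have "\<kappa> W (bond u ?v t) \<noteq> 0"
    using pauli_comm_bond [OF wl(2) vl ne(1) finite_lattice, of q W t] qA by (simp add: W_def)
  from other_term [OF Wl uv J_nonzero [OF t(1)] this]
  obtain P where P: "ham_term L d P" "\<kappa> W P \<noteq> 0" "P \<noteq> bond u ?v t"
    and PJ: "\<And>x y s. x \<noteq> y \<Longrightarrow> P = bond x y s \<Longrightarrow> J s \<noteq> 0" by blast
  have qP: "q (smul W P) \<noteq> 0" using P(2) by (auto simp: pauli_comm_def)
  have Wk: "layer L a \<alpha> x \<le> int k" if "W x \<noteq> None" for x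
    using that Ak [of x] lv u(2) by (auto simp: Wz split: if_splits)
  obtain s where s: "P = bond w ?m s" "W w = Some s" "anticomm (W ?m) s"
      "\<And>z. W z \<noteq> None \<Longrightarrow> layer L a \<alpha> z = 0 \<Longrightarrow> z = w"
  proof (rule two_ends [OF P(1,2) \<alpha> Wk, where x = w and y = ?v])
    show "layer L a \<alpha> w = 0" "layer L a \<alpha> ?v = int k" "0 \<le> int k" "int k \<le> int k"
      using w lv by simp_all
    show "W w \<noteq> None" using w ne by (simp add: Wz)
    show "W ?v \<noteq> None" using ne by (simp add: Wz)
    show "fits L \<alpha> (int k) (dom (smul W P))" using q_fits [OF qP \<alpha>] .
    \<comment> \<open>Removal at the top would make \<open>P\<close> the appended bond itself, which
      is excluded.\<close>
    fix t' assume "P = bond ?v (move L \<alpha> (- 1) ?v) t'" "W ?v = Some t'"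
    then have "P = bond u ?v t"
      using ne(1) move_0 [OF wl(2) \<alpha>] by (simp add: Wz move_move bond_commute)
    with P(3) show thesis by simp
  qed (assumption, rule that)
  define A' where "A' = smul W P"
  have A'z: "A' = (\<lambda>z. if z = w then None else if z = move L \<alpha> 1 w then pmul (A z) (Some s)
       else if z = u then pmul (A u) (Some t) else if z = ?v then Some t else A z)"
  proof
    fix z
    show "A' z = (if z = w then None else if z = move L \<alpha> 1 w then pmul (A z) (Some s)
       else if z = u then pmul (A u) (Some t) else if z = ?v then Some t else A z)"
    proof -
      consider "z = w" | "z = ?m" | "z = u" | "z = ?v" | "z \<noteq> w" "z \<noteq> ?m" "z \<noteq> u" "z \<noteq> ?v" by blast
      then show ?thesis
        by cases (use ne s(2) Wz in \<open>simp_all add: A'_def s(1) smul_def bond_def pmul_eq_None\<close>)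
    qed
  qed
  have Aw: "A w = Some s" "anticomm (A ?m) s" using s(2,3) ne by (simp_all add: Wz)
  have uniq: "z = w" if "A z \<noteq> None" "layer L a \<alpha> z = 0" for z
  proof (rule s(4) [OF _ that(2)])
    have "z \<noteq> u" "z \<noteq> ?v" using that(2) u(2) lv kk by auto
    then show "W z \<noteq> None" using that(1) by (simp add: Wz)
  qed
  have lay: "layer L (a + 1) \<alpha> z = layer L a \<alpha> z - 1" if "layer L a \<alpha> z \<ge> 1" for z
    using that layer_bounds [of L a \<alpha> z] kk unfolding layer_shift by simp
  have A'k: "layer L a \<alpha> z \<ge> 1 \<and> layer L a \<alpha> z \<le> int k" if "A' z \<noteq> None" for z
  proof -
    have "z = ?v \<or> A z \<noteq> None \<and> z \<noteq> w"
      using that Aw(2) u(1) by (auto simp: A'z anticomm_def split: if_splits)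
    then show ?thesis
    proof
      assume z: "A z \<noteq> None \<and> z \<noteq> w"
      then have "layer L a \<alpha> z \<noteq> 0" using uniq by blast
      then show ?thesis using z Ak [of z] kk layer_bounds [of L a \<alpha> z] by auto
    qed (use lv kk in simp)
  qed
  have "span \<alpha> (a + 1) A'"
    unfolding span_def
  proof (intro conjI allI impI exI)
    show "q A' \<noteq> 0" using qP by (simp add: A'_def)
    show "layer L (a + 1) \<alpha> z < int k" if "A' z \<noteq> None" for z
      using A'k [OF that] lay by simp
    show "A' ?m \<noteq> None" using ne Aw(2) by (simp add: A'z anticomm_def pmul_eq_None)
    show "layer L (a + 1) \<alpha> ?m = 0" using lay lm by simp
    show "A' ?v \<noteq> None" using ne by (simp add: A'z)
    show "layer L (a + 1) \<alpha> ?v = int k - 1" using lay lv kk by simp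
  qed (fact \<alpha>)
  moreover have "J s \<noteq> 0" using PJ [OF ne(6) s(1)] .
  ultimately show thesis using that Aw uniq A'z by blast
qed


section \<open>Strings of maximal width are straight lines\<close>

lemma layer_move_small:
  assumes "layer L a \<alpha> w = 0" "0 \<le> i" "i < int L"
  shows "layer L a \<alpha> (move L \<alpha> i w) = i"
  using assms by (simp add: layer_move)

lemma spanD:
  assumes "span \<alpha> a A"
  shows "q A \<noteq> 0" "\<alpha> \<in> {1..d}" "A x \<noteq> None \<Longrightarrow> layer L a \<alpha> x < int k"
    "A x \<noteq> None \<Longrightarrow> x \<in> lattice L d"
    "\<exists>x. A x \<noteq> None \<and> layer L a \<alpha> x = 0" "\<exists>x. A x \<noteq> None \<and> layer L a \<alpha> x = int k - 1"
  using assms q_dom [of A] unfolding span_def by blast+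

lemma other_pauli: "\<exists>t. t \<noteq> PZ \<and> a \<noteq> Some t"
  by (cases a rule: option_pauli_cases) auto

text \<open>Induction over all spanning strings at once: a shift keeps the support in layers 1 to
  \<open>k - 1\<close> and makes layer 1 the new bottom layer, so the hypothesis for the shifted
  string describes the next layers of \<open>A\<close>.\<close>

lemma line_prefix:
  assumes "span \<alpha> a A" "n < k"
  shows "\<exists>w. A w \<noteq> None \<and> layer L a \<alpha> w = 0 \<and>
    (\<forall>x. layer L a \<alpha> x \<le> int n \<longrightarrow> (A x \<noteq> None \<longleftrightarrow> (\<exists>i\<le>n. x = move L \<alpha> (int i) w)))"
  using assms
proof (induction n arbitrary: a A)
  case 0
  note \<alpha> = spanD(2) [OF 0(1)]
  obtain w u where w: "A w \<noteq> None" "layer L a \<alpha> w = 0"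
    and u: "A u \<noteq> None" "layer L a \<alpha> u = int k - 1"
    using spanD(5,6) [OF 0(1)] by blast
  obtain t where t: "t \<noteq> PZ" "A u \<noteq> Some t" using other_pauli by blast
  have uniq: "z = w" if "A z \<noteq> None" "layer L a \<alpha> z = 0" for z
    by (rule shift [OF 0(1) w u t]) (use that in blast)
  have w0: "move L \<alpha> 0 w = w" using move_0 spanD(4) [OF 0(1) w(1)] \<alpha> by blast
  have l0: "layer L a \<alpha> x = 0" if "layer L a \<alpha> x \<le> 0" for x
    using that layer_bounds [of L a \<alpha> x] L2 by simp
  have "A x \<noteq> None \<longleftrightarrow> (\<exists>i\<le>0. x = move L \<alpha> (int i) w)" if "layer L a \<alpha> x \<le> int 0" for x
  proof -
    have "A x \<noteq> None \<longleftrightarrow> x = w" using uniq [of x] l0 [of x] that w(1) by force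
    then show ?thesis using w0 by simp
  qed
  with w show ?case by blast
next
  case (Suc n)
  note \<alpha> = spanD(2) [OF Suc.prems(1)]
  have kk: "int k < int L" using k3 kL by simp
  obtain w u where w: "A w \<noteq> None" "layer L a \<alpha> w = 0"
    and u: "A u \<noteq> None" "layer L a \<alpha> u = int k - 1"
    using spanD(5,6) [OF Suc.prems(1)] by blast
  obtain t where t: "t \<noteq> PZ" "A u \<noteq> Some t" using other_pauli by blast
  let ?m = "move L \<alpha> 1 w" and ?v = "move L \<alpha> 1 u"
  obtain s A' where sA: "anticomm (A ?m) s"
    and uniq: "\<And>z. A z \<noteq> None \<Longrightarrow> layer L a \<alpha> z = 0 \<Longrightarrow> z = w"
    and A': "A' = (\<lambda>z. if z = w then None else if z = ?m then pmul (A z) (Some s)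
       else if z = u then pmul (A u) (Some t) else if z = ?v then Some t else A z)"
    and sp: "span \<alpha> (a + 1) A'"
    by (rule shift [OF Suc.prems(1) w u t]) (rule that)
  have wl: "w \<in> lattice L d" using spanD(4) [OF Suc.prems(1) w(1)] .
  have w0: "move L \<alpha> 0 w = w" using move_0 wl \<alpha> by blast
  have lm: "layer L a \<alpha> ?m = 1" and lv: "layer L a \<alpha> ?v = int k"
    using w u k3 kk by (simp_all add: layer_move)
  have A'iff: "A' z \<noteq> None \<longleftrightarrow> A z \<noteq> None" if "1 \<le> layer L a \<alpha> z" "layer L a \<alpha> z < int k" for z
  proof -
    have "z \<noteq> w" "z \<noteq> ?v" using that w lv by auto
    then show ?thesis using sA t u(1) by (auto simp: A' anticomm_def pmul_eq_None)
  qed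
  have lay: "layer L (a + 1) \<alpha> z = layer L a \<alpha> z - 1" if "layer L a \<alpha> z \<ge> 1" for z
    using that layer_bounds [of L a \<alpha> z] kk unfolding layer_shift by simp
  obtain w' where w': "layer L (a + 1) \<alpha> w' = 0" "A' w' \<noteq> None"
    and IH: "\<And>x. layer L (a + 1) \<alpha> x \<le> int n \<Longrightarrow> (A' x \<noteq> None \<longleftrightarrow> (\<exists>i\<le>n. x = move L \<alpha> (int i) w'))"
    using Suc.IH [OF sp Suc_lessD [OF Suc.prems(2)]] by blast
  \<comment> \<open>\<open>?m\<close> is occupied in \<open>A'\<close> and lies in its bottom layer,
    where the line found for \<open>A'\<close> has only its starting site.\<close>
  have "w' = ?m"
  proof -
    have "A' ?m \<noteq> None" using A'iff [of ?m] sA lm k3 by (simp add: anticomm_def)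
    then obtain i where i: "i \<le> n" "?m = move L \<alpha> (int i) w'"
      using IH [of ?m] lay [of ?m] lm by auto
    have "layer L (a + 1) \<alpha> ?m = int i"
      unfolding i(2) using i(1) Suc.prems(2) kk w' by (intro layer_move_small) auto
    then have "i = 0" using lay [of ?m] lm by simp
    moreover have "w' \<in> lattice L d" using spanD(4) [OF sp w'(2)] .
    ultimately show ?thesis using i(2) move_0 \<alpha> by simp
  qed
  show ?case
  proof (intro exI conjI allI impI)
    fix x assume x: "layer L a \<alpha> x \<le> int (Suc n)"
    show "A x \<noteq> None \<longleftrightarrow> (\<exists>i\<le>Suc n. x = move L \<alpha> (int i) w)"
    proof (cases "layer L a \<alpha> x = 0")
      case True
      have "i = 0" if "i \<le> Suc n" "x = move L \<alpha> (int i) w" for i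
        using layer_move_small [OF w(2), of "int i"] that Suc.prems(2) kk True by simp
      then have "(\<exists>i\<le>Suc n. x = move L \<alpha> (int i) w) \<longleftrightarrow> x = w" using w0 by fastforce
      then show ?thesis using uniq [OF _ True] w(1) by metis
    next
      case False
      then have l1: "layer L a \<alpha> x \<ge> 1" using layer_bounds [of L a \<alpha> x] L2 by auto
      have "A x \<noteq> None \<longleftrightarrow> A' x \<noteq> None" using A'iff [OF l1] x Suc.prems(2) by simp
      also have "\<dots> \<longleftrightarrow> (\<exists>i\<le>n. x = move L \<alpha> (int i) ?m)"
        using IH [of x] lay [OF l1] x \<open>w' = ?m\<close> by simp
      also have "\<dots> \<longleftrightarrow> (\<exists>i\<le>n. x = move L \<alpha> (int (Suc i)) w)"
        by (simp add: move_move add.commute)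
      also have "\<dots> \<longleftrightarrow> (\<exists>i\<le>Suc n. x = move L \<alpha> (int i) w)"
      proof
        assume "\<exists>i\<le>Suc n. x = move L \<alpha> (int i) w"
        then obtain i where i: "i \<le> Suc n" "x = move L \<alpha> (int i) w" by blast
        then have "i \<noteq> 0" using False w(2) w0 by (cases i) auto
        then obtain i' where "i = Suc i'" by (cases i) auto
        with i show "\<exists>i\<le>n. x = move L \<alpha> (int (Suc i)) w" by auto
      qed (metis Suc_le_mono)
      finally show ?thesis .
    qed
  qed (use w in auto)
qed

lemma line_support:
  assumes "span \<alpha> a A"
  obtains w where "w \<in> lattice L d" "layer L a \<alpha> w = 0"
    "\<And>x. A x \<noteq> None \<longleftrightarrow> (\<exists>i<k. x = move L \<alpha> (int i) w)"
proof -
  have k0: "0 < k" using k3 by simp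
  obtain w where w: "A w \<noteq> None" "layer L a \<alpha> w = 0"
    and *: "\<And>x. layer L a \<alpha> x \<le> int (k - 1) \<Longrightarrow> (A x \<noteq> None \<longleftrightarrow> (\<exists>i\<le>k - 1. x = move L \<alpha> (int i) w))"
    using line_prefix [OF assms, of "k - 1"] k0 by (metis diff_less zero_less_one)
  have ik: "i \<le> k - 1 \<longleftrightarrow> i < k" for i using k0 by auto
  have "A x \<noteq> None \<longleftrightarrow> (\<exists>i<k. x = move L \<alpha> (int i) w)" for x
  proof
    assume "A x \<noteq> None"
    then show "\<exists>i<k. x = move L \<alpha> (int i) w"
      using * [of x] spanD(3) [OF assms, of x] k0 ik by (auto simp: of_nat_diff simp del: One_nat_def)
  next
    assume "\<exists>i<k. x = move L \<alpha> (int i) w"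
    then obtain i where i: "i < k" "x = move L \<alpha> (int i) w" by blast
    then have "layer L a \<alpha> x = int i"
      using layer_move_small [OF w(2), of "int i"] k3 kL by simp
    moreover have "\<exists>i\<le>k - 1. x = move L \<alpha> (int i) w" using i ik by blast
    ultimately show "A x \<noteq> None" using * [of x] i(1) by simp
  qed
  then show thesis using that w spanD(4) [OF assms w(1)] by blast
qed

end

section \<open>Straight lines\<close>

text \<open>On \<open>PX\<close> and \<open>PY\<close> this is multiplication by \<open>PZ\<close>
  up to phase; the value at \<open>PZ\<close> is a filler that keeps \<open>alt\<close> an
  involution.\<close>

fun alt :: "pauli \<Rightarrow> pauli" where
  "alt PX = PY"
| "alt PY = PX"
| "alt PZ = PZ"

lemma alt_alt [simp]: "alt (alt t) = t"
  by (cases t) simp_all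

lemma alt_eq_PZ [simp]: "alt t = PZ \<longleftrightarrow> t = PZ"
  by (cases t) simp_all

lemma alt_neq: "t \<noteq> PZ \<Longrightarrow> alt t \<noteq> t"
  by (cases t) simp_all

lemma pmul_alt: "t \<noteq> PZ \<Longrightarrow> pmul (Some t) (Some (alt t)) = Some PZ"
  by (cases t) simp_all

lemma pmul_PZ: "t \<noteq> PZ \<Longrightarrow> pmul (Some PZ) (Some t) = Some (alt t)"
  by (cases t) simp_all

text \<open>Turns a word indexed by naturals into a string on the line through \<open>w\<close>.
  Positions are counted from \<open>w\<close> around the cycle, so only the letters below
  \<open>L\<close> matter.\<close>

definition on_line :: "nat \<Rightarrow> nat \<Rightarrow> nat \<Rightarrow> site \<Rightarrow> (nat \<Rightarrow> pauli option) \<Rightarrow> (site \<rightharpoonup> pauli)" where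
  "on_line L d \<alpha> w f x =
    (if x \<in> lattice L d \<and> (\<forall>\<beta>\<in>{1..d} - {\<alpha>}. x \<beta> = w \<beta>) then f (nat (layer L (w \<alpha>) \<alpha> x)) else None)"

text \<open>For \<open>n \<ge> 2\<close> this is the word \<open>l Z ... Z r\<close> with
  \<open>n\<close> letters starting at position \<open>j\<close>.\<close>

definition seg :: "nat \<Rightarrow> nat \<Rightarrow> pauli \<Rightarrow> pauli \<Rightarrow> nat \<Rightarrow> pauli option" where
  "seg j n l r i = (if i = j then Some l else if i + 1 = j + n then Some r
    else if j < i \<and> i + 1 < j + n then Some PZ else None)"

lemma layer_self: "layer L (w \<alpha>) \<alpha> w = 0"
  by (simp add: layer_def)

lemma on_line_move:
  assumes "w \<in> lattice L d" "\<alpha> \<in> {1..d}" "i < L"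
  shows "on_line L d \<alpha> w f (move L \<alpha> (int i) w) = f i"
  using assms move_in_lattice [OF assms(1,2)]
  by (simp add: on_line_def layer_move layer_self) (simp add: move_def)

lemma on_line_point:
  assumes "w \<in> lattice L d" "\<alpha> \<in> {1..d}" "x \<in> lattice L d" "\<forall>\<beta>\<in>{1..d} - {\<alpha>}. x \<beta> = w \<beta>"
  obtains i where "i < L" "x = move L \<alpha> (int i) w"
proof -
  have L: "L > 0" using lattice_coord [OF assms(1,2)] by linarith
  define i where "i = nat (layer L (w \<alpha>) \<alpha> x)"
  have i: "i < L" "int i = layer L (w \<alpha>) \<alpha> x"
    using layer_bounds [OF L, of "w \<alpha>" \<alpha> x] by (auto simp: i_def)
  have "x = move L \<alpha> (int i) w"
  proof (rule lattice_eqI [OF assms(3) move_in_lattice [OF assms(1,2)] assms(2)])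
    show "layer L (w \<alpha>) \<alpha> x = layer L (w \<alpha>) \<alpha> (move L \<alpha> (int i) w)"
      using i by (simp add: layer_move layer_self)
    show "x \<beta> = move L \<alpha> (int i) w \<beta>" if "\<beta> \<in> {1..d}" "\<beta> \<noteq> \<alpha>" for \<beta>
      using that assms(4) by (simp add: move_def)
  qed
  with i(1) show thesis by (rule that)
qed

lemma on_line_eqI:
  assumes "w \<in> lattice L d" "\<alpha> \<in> {1..d}"
    and "\<And>i. i < L \<Longrightarrow> A (move L \<alpha> (int i) w) = f i"
    and "\<And>x. A x \<noteq> None \<Longrightarrow> \<exists>i<L. x = move L \<alpha> (int i) w"
  shows "A = on_line L d \<alpha> w f"
proof
  fix x
  show "A x = on_line L d \<alpha> w f x"
  proof (cases "x \<in> lattice L d \<and> (\<forall>\<beta>\<in>{1..d} - {\<alpha>}. x \<beta> = w \<beta>)")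
    case True
    then obtain i where "i < L" "x = move L \<alpha> (int i) w"
      using on_line_point [OF assms(1,2)] by blast
    then show ?thesis using on_line_move [OF assms(1,2)] assms(3) by simp
  next
    case False
    have "x \<noteq> move L \<alpha> (int i) w" for i
    proof
      assume "x = move L \<alpha> (int i) w"
      moreover from this have "\<forall>\<beta>\<in>{1..d} - {\<alpha>}. x \<beta> = w \<beta>" by (simp add: move_def)
      ultimately show False using False move_in_lattice [OF assms(1,2)] by simp
    qed
    then have "A x = None" using assms(4) by blast
    then show ?thesis by (simp only: on_line_def if_not_P [OF False])
  qed
qed

lemma on_line_dom:
  assumes "w \<in> lattice L d" "\<alpha> \<in> {1..d}" "on_line L d \<alpha> w f x \<noteq> None"
  obtains i where "i < L" "x = move L \<alpha> (int i) w" "f i \<noteq> None"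
proof -
  have "x \<in> lattice L d" "\<forall>\<beta>\<in>{1..d} - {\<alpha>}. x \<beta> = w \<beta>"
    using assms(3) by (auto simp: on_line_def split: if_splits)
  from on_line_point [OF assms(1,2) this] obtain i where "i < L" "x = move L \<alpha> (int i) w" .
  then show thesis using that on_line_move [OF assms(1,2)] assms(3) by metis
qed

lemma move_inj:
  assumes "w \<in> lattice L d" "\<alpha> \<in> {1..d}" "i < L" "j < L" "move L \<alpha> (int i) w = move L \<alpha> (int j) w"
  shows "i = j"
proof -
  have "layer L (w \<alpha>) \<alpha> (move L \<alpha> (int i) w) = layer L (w \<alpha>) \<alpha> (move L \<alpha> (int j) w)"
    using assms(5) by simp
  then show ?thesis using assms(3,4) by (simp add: layer_move layer_self)
qed

lemma on_line_bond:
  assumes "w \<in> lattice L d" "\<alpha> \<in> {1..d}" "i < L" "j < L"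
  shows "smul (on_line L d \<alpha> w f) (bond (move L \<alpha> (int i) w) (move L \<alpha> (int j) w) t)
    = on_line L d \<alpha> w (\<lambda>z. if z = i \<or> z = j then pmul (f z) (Some t) else f z)"
proof (rule on_line_eqI [OF assms(1,2)])
  fix z assume z: "z < L"
  have "move L \<alpha> (int z) w = move L \<alpha> (int i) w \<longleftrightarrow> z = i" "move L \<alpha> (int z) w = move L \<alpha> (int j) w \<longleftrightarrow> z = j"
    using move_inj [OF assms(1,2) z] assms(3,4) by blast+
  then show "smul (on_line L d \<alpha> w f) (bond (move L \<alpha> (int i) w) (move L \<alpha> (int j) w) t) (move L \<alpha> (int z) w)
    = (if z = i \<or> z = j then pmul (f z) (Some t) else f z)"
    using on_line_move [OF assms(1,2) z] by (simp add: smul_def bond_def)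
next
  fix x assume x: "smul (on_line L d \<alpha> w f) (bond (move L \<alpha> (int i) w) (move L \<alpha> (int j) w) t) x \<noteq> None"
  show "\<exists>i<L. x = move L \<alpha> (int i) w"
  proof (cases "on_line L d \<alpha> w f x = None")
    case True
    then have "x = move L \<alpha> (int i) w \<or> x = move L \<alpha> (int j) w"
      using x by (auto simp: smul_def bond_def split: if_splits)
    then show ?thesis using assms(3,4) by blast
  next
    case False
    then show ?thesis using on_line_dom [OF assms(1,2)] by blast
  qed
qed

text \<open>The bond cancels the end letter \<open>r\<close> and multiplies the neighbouring
  \<open>PZ\<close> by \<open>r\<close>, so shortening by one letter swaps \<open>PX\<close> and
  \<open>PY\<close> at the end.\<close>

lemma seg_right:
  assumes "r \<noteq> PZ" "n \<ge> 2"
  shows "(\<lambda>z. if z = j + n - 1 \<or> z = j + n then pmul (seg j (Suc n) l r z) (Some r) else seg j (Suc n) l r z)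
    = seg j n l (alt r)"
proof
  fix z
  have "z = j + n \<or> z = j + n - 1 \<or> z \<noteq> j + n \<and> z \<noteq> j + n - 1" by blast
  then show "(if z = j + n - 1 \<or> z = j + n then pmul (seg j (Suc n) l r z) (Some r) else seg j (Suc n) l r z)
    = seg j n l (alt r) z"
    using assms pmul_PZ [OF assms(1)] by (elim disjE conjE) (auto simp: seg_def pmul_eq_None)
qed

lemma seg_left:
  assumes "l \<noteq> PZ" "n \<ge> 2"
  shows "(\<lambda>z. if z = j \<or> z = Suc j then pmul (seg j (Suc n) l r z) (Some l) else seg j (Suc n) l r z)
    = seg (Suc j) n (alt l) r"
proof
  fix z
  have "z = j \<or> z = Suc j \<or> z \<noteq> j \<and> z \<noteq> Suc j" by blast
  then show "(if z = j \<or> z = Suc j then pmul (seg j (Suc n) l r z) (Some l) else seg j (Suc n) l r z)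
    = seg (Suc j) n (alt l) r z"
    using assms pmul_PZ [OF assms(1)] by (elim disjE conjE) (auto simp: seg_def pmul_eq_None)
qed

text \<open>Take weights with \<open>w (Suc n) * a (Suc n) = - w n * b n\<close>. The first family
  makes \<open>w n * x n\<close> constant, and the weighted second family reads
  \<open>y n - y (Suc n) + g * x 0 = 0\<close>, with the outer terms missing at both ends. Summation
  gives \<open>of_nat N * (g * x 0) = 0\<close>.\<close>

lemma telescoping:
  fixes a b x e :: "nat \<Rightarrow> complex"
  assumes ne: "\<And>n. a n \<noteq> 0" "\<And>n. b n \<noteq> 0" and g: "g \<noteq> 0" and x0: "x 0 \<noteq> 0" and N: "N \<ge> 1"
    and 1: "\<And>n. Suc n < N \<Longrightarrow> a (Suc n) * x n + b n * x (Suc n) = 0"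
    and 2: "\<And>n. n < N \<Longrightarrow> (if n = 0 then 0 else a n * e n) + (if Suc n = N then 0 else b n * e (Suc n)) + g * x n = 0"
  shows False
proof -
  define w where "w = rec_nat (1::complex) (\<lambda>n v. - v * b n / a (Suc n))"
  have w: "w 0 = 1" "\<And>n. w (Suc n) = - w n * b n / a (Suc n)" by (simp_all add: w_def)
  have wa: "w (Suc n) * a (Suc n) = - w n * b n" for n using ne by (simp add: w)
  have X: "n < N \<Longrightarrow> w n * x n = x 0" for n
  proof (induction n)
    case (Suc n)
    have 1: "b n * x (Suc n) = - (a (Suc n) * x n)"
      using 1 [OF Suc.prems] by (simp only: add_eq_0_iff)
    have "b n * (w (Suc n) * x (Suc n)) = w (Suc n) * (b n * x (Suc n))" by simp
    also have "\<dots> = - (w (Suc n) * a (Suc n)) * x n" by (simp add: 1)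
    also have "\<dots> = b n * x 0" using Suc wa [of n] by simp
    finally show ?case using ne(2) [of n] by simp
  qed (simp add: w)
  define y where "y = (\<lambda>n. if n = 0 then 0 else w n * a n * e n)"
  have step: "y n + (if Suc n = N then 0 else - y (Suc n)) + g * x 0 = 0" if "n < N" for n
  proof -
    have "w n * ((if n = 0 then 0 else a n * e n) + (if Suc n = N then 0 else b n * e (Suc n)) + g * x n) = 0"
      using 2 [OF that] by simp
    moreover have "w n * (if n = 0 then 0 else a n * e n) = y n" by (simp add: y_def)
    moreover have "w n * (if Suc n = N then 0 else b n * e (Suc n)) = (if Suc n = N then 0 else - y (Suc n))"
      using wa [of n] by (simp add: y_def)
    moreover have "w n * (g * x n) = g * x 0" using X [OF that] by (simp add: mult.left_commute)
    ultimately show ?thesis by (simp add: distrib_left)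
  qed
  have Y: "n < N \<Longrightarrow> y n = of_nat n * (g * x 0)" for n
  proof (induction n)
    case (Suc n)
    then show ?case using step [of n] by (simp add: algebra_simps)
  qed (simp add: y_def)
  have "of_nat N * (g * x 0) = 0"
    using step [of "N - 1"] Y [of "N - 1"] N by (simp add: algebra_simps of_nat_diff)
  with g x0 N show False by simp
qed

section \<open>Repeated shifts produce a line with \<open>PZ\<close> in its interior\<close>

context conserved
begin

text \<open>\<open>shift\<close> in terms of words: the letters move back by one position,
  \<open>t\<close> is appended, and the former last letter is multiplied by \<open>t\<close>. The
  new first letter is not recorded; it is recovered at the end from the condition for one more
  shift.\<close>

lemma line_step:
  assumes A: "span \<alpha> a A" and w: "w \<in> lattice L d" "layer L a \<alpha> w = 0"
    and line: "\<And>x. A x \<noteq> None \<longleftrightarrow> (\<exists>i<k. x = move L \<alpha> (int i) w)"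
    and t: "t \<noteq> PZ" "A (move L \<alpha> (int (k - 1)) w) \<noteq> Some t"
  obtains s A' where "A w = Some s" "J s \<noteq> 0" "anticomm (A (move L \<alpha> 1 w)) s"
    "span \<alpha> (a + 1) A'" "layer L (a + 1) \<alpha> (move L \<alpha> 1 w) = 0"
    "\<And>x. A' x \<noteq> None \<longleftrightarrow> (\<exists>i<k. x = move L \<alpha> (int i) (move L \<alpha> 1 w))"
    "A' (move L \<alpha> (int (k - 1)) (move L \<alpha> 1 w)) = Some t"
    "A' (move L \<alpha> (int (k - 2)) (move L \<alpha> 1 w)) = pmul (A (move L \<alpha> (int (k - 1)) w)) (Some t)"
    "\<And>i. 1 \<le> i \<Longrightarrow> i < k - 2 \<Longrightarrow>
      A' (move L \<alpha> (int i) (move L \<alpha> 1 w)) = A (move L \<alpha> (int (Suc i)) w)"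
proof -
  note \<alpha> = spanD(2) [OF A]
  let ?u = "move L \<alpha> (int (k - 1)) w" and ?m = "move L \<alpha> 1 w"
  have kk: "int k < int L" "3 \<le> int k" using k3 kL by auto
  have w0: "move L \<alpha> 0 w = w" using move_0 w \<alpha> by blast
  have Aw: "A w \<noteq> None" unfolding line using w0 k3 by (intro exI [of _ 0]) auto
  have Au: "A ?u \<noteq> None" unfolding line using k3 by (intro exI [of _ "k - 1"]) auto
  have lu: "layer L a \<alpha> ?u = int k - 1"
    using layer_move_small [OF w(2), of "int (k - 1)"] kk by (simp add: of_nat_diff)
  obtain s A' where s: "A w = Some s" "J s \<noteq> 0" "anticomm (A ?m) s"
    and A': "A' = (\<lambda>z. if z = w then None else if z = ?m then pmul (A z) (Some s)
       else if z = ?u then pmul (A ?u) (Some t) else if z = move L \<alpha> 1 ?u then Some t else A z)"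
    and sp: "span \<alpha> (a + 1) A'"
    by (rule shift [OF A Aw w(2) Au lu t]) (rule that)
  have lay: "layer L a \<alpha> (move L \<alpha> (int i) w) = int i" if "i < L" for i
    using layer_move_small [OF w(2), of "int i"] that by simp
  have inj: "move L \<alpha> (int i) w = move L \<alpha> (int j) w \<longleftrightarrow> i = j" if "i < L" "j < L" for i j
    using move_inj [OF w(1) \<alpha> that] by blast
  have mm: "move L \<alpha> (int i) ?m = move L \<alpha> (int (Suc i)) w" for i
    by (simp add: move_move add.commute)
  have v: "move L \<alpha> 1 ?u = move L \<alpha> (int k) w" using k3 by (simp add: move_move of_nat_diff)
  have A'i: "A' (move L \<alpha> (int i) w) = (if i = 0 then None else if i = 1 then pmul (A ?m) (Some s)
       else if i = k - 1 then pmul (A ?u) (Some t) else if i = k then Some t else A (move L \<alpha> (int i) w))"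
    if "i < L" for i
  proof -
    have "move L \<alpha> (int i) w = w \<longleftrightarrow> i = 0" "move L \<alpha> (int i) w = ?m \<longleftrightarrow> i = 1"
      "move L \<alpha> (int i) w = ?u \<longleftrightarrow> i = k - 1" "move L \<alpha> (int i) w = move L \<alpha> (int k) w \<longleftrightarrow> i = k"
      using inj [OF that, of 0] inj [OF that, of 1] inj [OF that, of "k - 1"] inj [OF that, of k] w0 kk by auto
    then show ?thesis unfolding A' v by auto
  qed
  have lm: "layer L (a + 1) \<alpha> ?m = 0"
    using layer_move_small [OF w(2), of 1] kk by (simp add: layer_shift)
  obtain w' where w': "w' \<in> lattice L d" "layer L (a + 1) \<alpha> w' = 0"
    and line': "\<And>x. A' x \<noteq> None \<longleftrightarrow> (\<exists>i<k. x = move L \<alpha> (int i) w')"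
    using line_support [OF sp] by blast
  have "w' = ?m"
  proof -
    have "A' ?m \<noteq> None" using A'i [of 1] s(3) kk by (simp add: anticomm_def pmul_eq_None)
    then obtain i where i: "i < k" "?m = move L \<alpha> (int i) w'" using line' by blast
    have "layer L (a + 1) \<alpha> (move L \<alpha> (int i) w') = int i"
      using layer_move_small [OF w'(2), of "int i"] i(1) kk by simp
    then have "i = 0" using lm i(2) by simp
    then show ?thesis using i(2) move_0 [OF w'(1) \<alpha>] by simp
  qed
  show thesis
  proof (rule that [OF s sp lm])
    show "A' x \<noteq> None \<longleftrightarrow> (\<exists>i<k. x = move L \<alpha> (int i) ?m)" for x
      using line' unfolding \<open>w' = ?m\<close> .
    show "A' (move L \<alpha> (int (k - 1)) ?m) = Some t"
    proof -
      have "Suc (k - 1) = k" "k \<noteq> k - 1" "k \<noteq> 0" "k \<noteq> 1" "k < L" using k3 kL by auto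
      then show ?thesis unfolding mm using A'i [of "Suc (k - 1)"] by simp
    qed
    show "A' (move L \<alpha> (int (k - 2)) ?m) = pmul (A ?u) (Some t)"
    proof -
      have "Suc (k - 2) = k - 1" "k - 1 \<noteq> 0" "k - 1 \<noteq> 1" "k - 1 < L" using k3 kL by auto
      then show ?thesis unfolding mm using A'i [of "Suc (k - 2)"] by simp
    qed
    show "A' (move L \<alpha> (int i) ?m) = A (move L \<alpha> (int (Suc i)) w)" if "1 \<le> i" "i < k - 2" for i
    proof -
      have "Suc i \<noteq> 0" "Suc i \<noteq> 1" "Suc i \<noteq> k - 1" "Suc i \<noteq> k" "Suc i < L" using that k3 kL by auto
      then show ?thesis unfolding mm using A'i [of "Suc i"] by simp
    qed
  qed
qed

text \<open>\<open>m\<close> counts shifts. Each one after the first appends \<open>alt r\<close>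
  behind the last letter \<open>r\<close>, which thereby becomes \<open>PZ\<close>; so after
  \<open>m\<close> shifts the \<open>m - 1\<close> letters before the end are
  \<open>PZ\<close>.\<close>

lemma strip_stage:
  assumes A: "span \<alpha> a A" and "1 \<le> m" "m < k"
  shows "\<exists>b B w r. span \<alpha> b B \<and> w \<in> lattice L d \<and> layer L b \<alpha> w = 0 \<and>
    (\<forall>x. B x \<noteq> None \<longleftrightarrow> (\<exists>i<k. x = move L \<alpha> (int i) w)) \<and> r \<noteq> PZ \<and>
    B (move L \<alpha> (int (k - 1)) w) = Some r \<and>
    (\<forall>i. k - m \<le> i \<longrightarrow> Suc i < k \<longrightarrow> B (move L \<alpha> (int i) w) = Some PZ)"
  using assms(2,3)
proof (induction m rule: nat_induct_at_least)
  case base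
  note \<alpha> = spanD(2) [OF A]
  obtain w where w: "w \<in> lattice L d" "layer L a \<alpha> w = 0"
    and line: "\<And>x. A x \<noteq> None \<longleftrightarrow> (\<exists>i<k. x = move L \<alpha> (int i) w)"
    using line_support [OF A] by blast
  obtain t where t: "t \<noteq> PZ" "A (move L \<alpha> (int (k - 1)) w) \<noteq> Some t" using other_pauli by blast
  obtain A' where "span \<alpha> (a + 1) A'" "layer L (a + 1) \<alpha> (move L \<alpha> 1 w) = 0"
    "\<And>x. A' x \<noteq> None \<longleftrightarrow> (\<exists>i<k. x = move L \<alpha> (int i) (move L \<alpha> 1 w))"
    "A' (move L \<alpha> (int (k - 1)) (move L \<alpha> 1 w)) = Some t"
    by (rule line_step [OF A w line t]) (rule that)
  moreover have "\<not> (k - 1 \<le> i \<and> Suc i < k)" for i by auto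
  moreover have "move L \<alpha> 1 w \<in> lattice L d" using move_in_lattice w(1) \<alpha> by blast
  ultimately show ?case using t(1) by blast
next
  case (Suc m)
  note \<alpha> = spanD(2) [OF A]
  obtain b B w r where B: "span \<alpha> b B" and w: "w \<in> lattice L d" "layer L b \<alpha> w = 0"
    and line: "\<And>x. B x \<noteq> None \<longleftrightarrow> (\<exists>i<k. x = move L \<alpha> (int i) w)" and r: "r \<noteq> PZ"
    and Br: "B (move L \<alpha> (int (k - 1)) w) = Some r"
    and BZ: "\<And>i. k - m \<le> i \<Longrightarrow> Suc i < k \<Longrightarrow> B (move L \<alpha> (int i) w) = Some PZ"
    using Suc.IH Suc_lessD [OF Suc.prems] by blast
  have t: "alt r \<noteq> PZ" "B (move L \<alpha> (int (k - 1)) w) \<noteq> Some (alt r)"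
    using r alt_neq [OF r] Br by auto
  let ?m = "move L \<alpha> 1 w"
  obtain B' where B': "span \<alpha> (b + 1) B'" "layer L (b + 1) \<alpha> ?m = 0"
    "\<And>x. B' x \<noteq> None \<longleftrightarrow> (\<exists>i<k. x = move L \<alpha> (int i) ?m)"
    and last: "B' (move L \<alpha> (int (k - 1)) ?m) = Some (alt r)"
    and last2: "B' (move L \<alpha> (int (k - 2)) ?m) = pmul (B (move L \<alpha> (int (k - 1)) w)) (Some (alt r))"
    and mid: "\<And>i. 1 \<le> i \<Longrightarrow> i < k - 2 \<Longrightarrow> B' (move L \<alpha> (int i) ?m) = B (move L \<alpha> (int (Suc i)) w)"
    by (rule line_step [OF B w line t]) (rule that)
  have "B' (move L \<alpha> (int i) ?m) = Some PZ" if i: "k - Suc m \<le> i" "Suc i < k" for i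
  proof (cases "i = k - 2")
    case True
    then show ?thesis using last2 Br pmul_alt [OF r] by simp
  next
    case False
    then show ?thesis using mid [of i] BZ [of "Suc i"] i Suc.prems by simp
  qed
  moreover have "?m \<in> lattice L d" using move_in_lattice w(1) \<alpha> by blast
  ultimately show ?case using B' last t(1) by blast
qed

text \<open>After \<open>k - 1\<close> shifts only the first letter is unknown. One more shift is
  made merely to read it off: it anticommutes with the \<open>PZ\<close> next to it, hence is
  \<open>PX\<close> or \<open>PY\<close>.\<close>

lemma strip_start:
  assumes A: "span \<alpha> a A"
  obtains w l r where "w \<in> lattice L d" "l \<noteq> PZ" "r \<noteq> PZ" "q (on_line L d \<alpha> w (seg 0 k l r)) \<noteq> 0"
proof -
  note \<alpha> = spanD(2) [OF A]
  have k1: "1 \<le> k - 1" "k - 1 < k" using k3 by auto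
  obtain b B w r where *: "span \<alpha> b B \<and> w \<in> lattice L d \<and> layer L b \<alpha> w = 0 \<and>
    (\<forall>x. B x \<noteq> None \<longleftrightarrow> (\<exists>i<k. x = move L \<alpha> (int i) w)) \<and> r \<noteq> PZ \<and>
    B (move L \<alpha> (int (k - 1)) w) = Some r \<and>
    (\<forall>i. k - (k - 1) \<le> i \<longrightarrow> Suc i < k \<longrightarrow> B (move L \<alpha> (int i) w) = Some PZ)"
    using strip_stage [OF A k1] by (elim exE) (rule that)
  from * have B: "span \<alpha> b B" by (elim conjE)
  from * have w1: "w \<in> lattice L d" by (elim conjE)
  from * have w2: "layer L b \<alpha> w = 0" by (elim conjE)
  note w = w1 w2
  from * have r: "r \<noteq> PZ" by (elim conjE)
  from * have Br: "B (move L \<alpha> (int (k - 1)) w) = Some r" by (elim conjE)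
  have line: "B x \<noteq> None \<longleftrightarrow> (\<exists>i<k. x = move L \<alpha> (int i) w)" for x
    using * by (elim conjE) (erule spec)
  have BZ: "B (move L \<alpha> (int i) w) = Some PZ" if "1 \<le> i" "Suc i < k" for i
  proof -
    have "k - (k - 1) \<le> i" using that by simp
    then show ?thesis using * that(2) by (elim conjE) (drule spec [of _ i], simp only: simp_thms)
  qed
  have t: "alt r \<noteq> PZ" "B (move L \<alpha> (int (k - 1)) w) \<noteq> Some (alt r)"
    using r alt_neq [OF r] Br by auto
  obtain l where l: "B w = Some l" "anticomm (B (move L \<alpha> 1 w)) l"
    by (rule line_step [OF B w line t]) (rule that)
  have "B (move L \<alpha> 1 w) = Some PZ" using BZ [of 1] k3 by simp
  then have "l \<noteq> PZ" using l(2) by (auto simp: anticomm_def)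
  have "B = on_line L d \<alpha> w (seg 0 k l r)"
  proof (rule on_line_eqI [OF w(1) \<alpha>])
    fix i assume i: "i < L"
    consider "i = 0" | "i = k - 1" "i \<noteq> 0" | "1 \<le> i" "Suc i < k" | "i \<ge> k" "i \<noteq> 0" using k3 by linarith
    then show "B (move L \<alpha> (int i) w) = seg 0 k l r i"
    proof cases
      case 1
      then show ?thesis using l(1) move_0 [OF w(1) \<alpha>] by (simp add: seg_def)
    next
      case 2
      then show ?thesis using Br k3 by (simp add: seg_def)
    next
      case 3
      then show ?thesis using BZ [of i] k3 by (simp add: seg_def)
    next
      case 4
      have "i' = i" if "i' < k" "move L \<alpha> (int i) w = move L \<alpha> (int i') w" for i'
        using move_inj [OF w(1) \<alpha> i _ that(2)] that(1) kL by simp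
      then have "\<not> (\<exists>i'<k. move L \<alpha> (int i) w = move L \<alpha> (int i') w)" using 4(1) by (metis not_le)
      then have "B (move L \<alpha> (int i) w) = None" using line [of "move L \<alpha> (int i) w"] by (metis (no_types))
      then show ?thesis using 4 k3 by (simp add: seg_def)
    qed
  next
    show "\<exists>i<L. x = move L \<alpha> (int i) w" if Bx: "B x \<noteq> None" for x
    proof -
      obtain i where "i < k" "x = move L \<alpha> (int i) w" using Bx line [of x] by blast
      then show ?thesis using kL by (intro exI [of _ i]) auto
    qed
  qed
  then show thesis using that [OF w(1) \<open>l \<noteq> PZ\<close> r] spanD(1) [OF B] by simp
qed

end

section \<open>Relations between coefficients\<close>

lemma phase_self: "phase a a = 1"
  by (cases a rule: option_pauli_cases) simp_all

lemma anticomm_pmul: "anticomm (pmul a (Some t)) t \<longleftrightarrow> anticomm a t"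
  by (auto simp: anticomm_def pmul_eq_None pmul_eq_Some)

text \<open>Multiplying a relation for \<open>D \<cdot> S\<close> by \<open>sphase D S\<close> makes the signs of the terms the
  same as in the relation for \<open>D\<close>, up to terms that anticommute with \<open>S\<close>.\<close>

definition attach :: "site set \<Rightarrow> ((site \<rightharpoonup> pauli) \<Rightarrow> complex) \<Rightarrow> (site \<rightharpoonup> pauli) \<Rightarrow> (site \<rightharpoonup> pauli) \<Rightarrow> complex" where
  "attach \<Lambda> q S A = sphase \<Lambda> A S * q (smul A S)"

lemma attach_commute:
  assumes "sphase \<Lambda> S P = sphase \<Lambda> P S"
  shows "sphase \<Lambda> D S * pauli_comm \<Lambda> q (smul D S) P = pauli_comm \<Lambda> (attach \<Lambda> q S) D P"
proof -
  have 1: "sphase \<Lambda> D S * sphase \<Lambda> (smul D S) P = sphase \<Lambda> D P * sphase \<Lambda> (smul D P) S"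
    using sphase_cocycle [of \<Lambda> D S P] sphase_cocycle [of \<Lambda> D P S] assms by (simp add: smul_commute)
  have 2: "sphase \<Lambda> D S * sphase \<Lambda> P (smul D S) = sphase \<Lambda> P D * sphase \<Lambda> (smul D P) S"
    using sphase_cocycle [of \<Lambda> P D S] by (simp add: smul_commute)
  have 3: "smul (smul D S) P = smul (smul D P) S"
    by (metis smul_assoc smul_commute)
  show ?thesis
    unfolding pauli_comm_def attach_def 3 using 1 2 by (simp add: left_diff_distrib right_diff_distrib) (simp add: mult.assoc [symmetric])
qed

text \<open>The two sign changes cancel, so \<open>P\<close> commutes with
  \<open>smul D S\<close>.\<close>

lemma attach_anticommute:
  assumes "sphase \<Lambda> S P = - sphase \<Lambda> P S" "sphase \<Lambda> D P = - sphase \<Lambda> P D"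
  shows "pauli_comm \<Lambda> q (smul D S) P = 0"
proof -
  have "sphase \<Lambda> P S * (sphase \<Lambda> D S * sphase \<Lambda> (smul D S) P) = sphase \<Lambda> P S * (sphase \<Lambda> S P * sphase \<Lambda> D (smul S P))"
    by (simp add: sphase_cocycle)
  also have "\<dots> = - (sphase \<Lambda> P S * (sphase \<Lambda> P S * sphase \<Lambda> D (smul P S)))"
    using assms(1) by (simp add: smul_commute)
  also have "\<dots> = - (sphase \<Lambda> P S * (sphase \<Lambda> D P * sphase \<Lambda> (smul D P) S))"
    by (simp add: sphase_cocycle)
  also have "\<dots> = sphase \<Lambda> P S * (sphase \<Lambda> P D * sphase \<Lambda> (smul P D) S)"
    using assms(2) by (simp add: smul_commute)
  also have "\<dots> = sphase \<Lambda> P S * (sphase \<Lambda> D S * sphase \<Lambda> P (smul D S))"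
    by (simp add: sphase_cocycle)
  finally have "sphase \<Lambda> (smul D S) P = sphase \<Lambda> P (smul D S)"
    using sphase_nonzero by simp
  then show ?thesis by (simp add: pauli_comm_def)
qed

section \<open>Relations for lines with and without an attached bond\<close>

context conserved
begin

text \<open>\<open>bond_sum\<close> in the form in which \<open>two_ends\<close> and
  \<open>term_removal\<close> classify terms. A field term in the list would have to be a bond with
  two distinct sites, which its support forbids.\<close>

lemma bond_sum_terms:
  assumes W: "dom W \<subseteq> lattice L d" and B: "B \<subseteq> nbr_pairs L d \<times> UNIV"
    and anti: "\<And>u v t. ((u, v), t) \<in> B \<Longrightarrow> ((v, u), t) \<notin> B"
    and terms: "\<And>P. ham_term L d P \<Longrightarrow> \<kappa> W P \<noteq> 0 \<Longrightarrow> \<exists>u v t. ((u, v), t) \<in> B \<and> P = bond u v t"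
  shows "(\<Sum>((u, v), t)\<in>B. of_real (J t) * \<kappa> W (bond u v t)) = 0"
proof (rule bond_sum [OF W B anti])
  fix u v t assume *: "(u, v) \<in> nbr_pairs L d" "\<kappa> W (bond u v t) \<noteq> 0"
  obtain u' v' t' where "((u', v'), t') \<in> B" and eq: "bond u v t = bond u' v' t'"
    using terms [OF ham_term.intros(1) [OF *(1)] *(2)] by blast
  then show "((u, v), t) \<in> B \<or> ((v, u), t) \<in> B"
    using bond_eqD [OF eq] by (auto simp: doubleton_eq_iff)
next
  fix u t assume u: "u \<in> lattice L d"
  show "\<kappa> W [u \<mapsto> t] = 0"
  proof (rule ccontr)
    assume "\<kappa> W [u \<mapsto> t] \<noteq> 0"
    then obtain x y s where "((x, y), s) \<in> B" and eq: "[u \<mapsto> t] = bond x y s"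
      using terms [OF ham_term.intros(2) [OF u]] by blast
    then have "x \<noteq> y" using B nbr_ne by blast
    with arg_cong [OF eq, of dom] show False by (auto simp: dom_bond)
  qed
qed assumption

text \<open>\<open>q_fits\<close> supplies a window of \<open>k\<close> layers; if its first or last
  layer were empty, it could be shrunk to \<open>k - 1\<close>.\<close>

lemma span_exists:
  assumes "q A \<noteq> 0" "\<alpha> \<in> {1..d}" "\<not> fits L \<alpha> (int k - 1) (dom A)"
  obtains a where "span \<alpha> a A"
proof -
  have L0: "0 < L" using L2 by simp
  obtain a where a: "\<And>u. u \<in> dom A \<Longrightarrow> layer L a \<alpha> u < int k"
    using q_fits [OF assms(1,2)] unfolding fits_def by blast
  have "\<exists>x. A x \<noteq> None \<and> layer L a \<alpha> x = 0"
  proof (rule ccontr)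
    assume no: "\<not> (\<exists>x. A x \<noteq> None \<and> layer L a \<alpha> x = 0)"
    have "layer L (a + 1) \<alpha> x < int k - 1" if x: "x \<in> dom A" for x
    proof -
      have "layer L a \<alpha> x \<noteq> 0" using no x by blast
      then have "layer L a \<alpha> x \<ge> 1" using layer_bounds [OF L0, of a \<alpha> x] by linarith
      then have "layer L (a + 1) \<alpha> x = layer L a \<alpha> x - 1"
        using layer_bounds [OF L0, of a \<alpha> x] unfolding layer_shift by simp
      then show ?thesis using a [OF x] by simp
    qed
    then show False using assms(3) unfolding fits_def by blast
  qed
  moreover have "\<exists>x. A x \<noteq> None \<and> layer L a \<alpha> x = int k - 1"
  proof (rule ccontr)
    assume no: "\<not> (\<exists>x. A x \<noteq> None \<and> layer L a \<alpha> x = int k - 1)"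
    have "layer L a \<alpha> x < int k - 1" if x: "x \<in> dom A" for x
    proof -
      have "layer L a \<alpha> x \<noteq> int k - 1" using no x by blast
      then show ?thesis using a [OF x] by linarith
    qed
    then show False using assms(3) unfolding fits_def by blast
  qed
  moreover have "\<forall>x. A x \<noteq> None \<longrightarrow> layer L a \<alpha> x < int k" using a by blast
  ultimately have "span \<alpha> a A" unfolding span_def using assms(1,2) by (intro conjI)
  then show thesis by (rule that)
qed

lemma layer_line:
  assumes "j \<le> i" "i < L"
  shows "layer L (w \<alpha> + int j) \<alpha> (move L \<alpha> (int i) w) = int i - int j"
proof -
  have "layer L (w \<alpha>) \<alpha> (move L \<alpha> (int i) w) = int i"
    using assms by (simp add: layer_move layer_self)
  then show ?thesis using assms unfolding layer_shift by simp
qed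

lemma seg_dom: "n \<ge> 2 \<Longrightarrow> seg j n l r i \<noteq> None \<longleftrightarrow> j \<le> i \<and> i < j + n"
  by (auto simp: seg_def)

lemma move_nbr: "w \<in> lattice L d \<Longrightarrow> \<alpha> \<in> {1..d} \<Longrightarrow>
    (move L \<alpha> (int i) w, move L \<alpha> (int (Suc i)) w) \<in> nbr_pairs L d"
  unfolding nbr_pairs_iff using move_in_lattice [of w L d \<alpha>]
  by (auto simp: move_move intro!: bexI [of _ \<alpha>])

lemma on_line_lattice: "dom (on_line L d \<alpha> w f) \<subseteq> lattice L d"
  by (auto simp: on_line_def split: if_splits)

text \<open>The bond anticommutes with \<open>D\<close> at the neighbouring \<open>PZ\<close> only.
  \<open>f\<close> is arbitrary because both \<open>q\<close> and \<open>attach\<close> will be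
  inserted.\<close>

lemma comm_end:
  assumes "(x, y) \<in> nbr_pairs L d" and D: "D x = Some t" "D y = Some PZ" and t: "t \<noteq> PZ"
  shows "pauli_comm (lattice L d) f D (bond x y t) = 2 * phase (Some PZ) (Some t) * f (smul D (bond x y t))"
    and "sphase (lattice L d) (bond x y t) D = - sphase (lattice L d) D (bond x y t)"
proof -
  have xy: "x \<in> lattice L d" "y \<in> lattice L d" "x \<noteq> y"
    using assms(1) nbr_ne by (auto dest: nbr_pairs_lattice)
  show "pauli_comm (lattice L d) f D (bond x y t) = 2 * phase (Some PZ) (Some t) * f (smul D (bond x y t))"
    using t by (simp add: pauli_comm_bond [OF xy finite_lattice] D phase_self anticomm_def)
  show "sphase (lattice L d) (bond x y t) D = - sphase (lattice L d) D (bond x y t)"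
    using t by (cases t) (simp_all add: sphase_bond [OF xy finite_lattice] D phase_self)
qed

lemma comm_left:
  fixes w \<alpha> defines "p \<equiv> \<lambda>i. move L \<alpha> (int i) w"
  assumes w: "w \<in> lattice L d" and \<alpha>: "\<alpha> \<in> {1..d}" and "l \<noteq> PZ" "n \<ge> 2" "j + n < L"
  shows "pauli_comm (lattice L d) f (on_line L d \<alpha> w (seg j (Suc n) l r)) (bond (p j) (p (Suc j)) l)
    = 2 * phase (Some PZ) (Some l) * f (on_line L d \<alpha> w (seg (Suc j) n (alt l) r))" (is ?A)
    and "sphase (lattice L d) (bond (p j) (p (Suc j)) l) (on_line L d \<alpha> w (seg j (Suc n) l r))
    = - sphase (lattice L d) (on_line L d \<alpha> w (seg j (Suc n) l r)) (bond (p j) (p (Suc j)) l)" (is ?B)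
proof -
  have jL: "j < L" "Suc j < L" using assms by auto
  have v: "on_line L d \<alpha> w (seg j (Suc n) l r) (p j) = Some l"
    "on_line L d \<alpha> w (seg j (Suc n) l r) (p (Suc j)) = Some PZ"
    using on_line_move [OF w \<alpha> jL(1)] on_line_move [OF w \<alpha> jL(2)] assms(5) unfolding p_def
    by (simp_all only:) (simp_all add: seg_def)
  have sm: "smul (on_line L d \<alpha> w (seg j (Suc n) l r)) (bond (p j) (p (Suc j)) l)
    = on_line L d \<alpha> w (seg (Suc j) n (alt l) r)"
    unfolding p_def on_line_bond [OF w \<alpha> jL] seg_left [OF assms(4,5)] ..
  have nb: "(p j, p (Suc j)) \<in> nbr_pairs L d" unfolding p_def by (rule move_nbr [OF w \<alpha>])
  show ?A unfolding comm_end(1) [OF nb v assms(4)] sm ..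
  show ?B by (rule comm_end(2) [OF nb v assms(4)])
qed

lemma comm_right:
  fixes w \<alpha> defines "p \<equiv> \<lambda>i. move L \<alpha> (int i) w"
  assumes w: "w \<in> lattice L d" and \<alpha>: "\<alpha> \<in> {1..d}" and "r \<noteq> PZ" "n \<ge> 2" "j + n < L"
  shows "pauli_comm (lattice L d) f (on_line L d \<alpha> w (seg j (Suc n) l r)) (bond (p (j + n - 1)) (p (j + n)) r)
    = 2 * phase (Some PZ) (Some r) * f (on_line L d \<alpha> w (seg j n l (alt r)))" (is ?A)
    and "sphase (lattice L d) (bond (p (j + n - 1)) (p (j + n)) r) (on_line L d \<alpha> w (seg j (Suc n) l r))
    = - sphase (lattice L d) (on_line L d \<alpha> w (seg j (Suc n) l r)) (bond (p (j + n - 1)) (p (j + n)) r)" (is ?B)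
proof -
  have jL: "j + n - 1 < L" "j + n < L" using assms by auto
  have v: "on_line L d \<alpha> w (seg j (Suc n) l r) (p (j + n)) = Some r"
    "on_line L d \<alpha> w (seg j (Suc n) l r) (p (j + n - 1)) = Some PZ"
  proof -
    have "seg j (Suc n) l r (j + n) = Some r" "seg j (Suc n) l r (j + n - 1) = Some PZ"
      using assms(5) by (auto simp: seg_def)
    then show "on_line L d \<alpha> w (seg j (Suc n) l r) (p (j + n)) = Some r"
      "on_line L d \<alpha> w (seg j (Suc n) l r) (p (j + n - 1)) = Some PZ"
      unfolding p_def on_line_move [OF w \<alpha> jL(1)] on_line_move [OF w \<alpha> jL(2)] by auto
  qed
  have sm: "smul (on_line L d \<alpha> w (seg j (Suc n) l r)) (bond (p (j + n)) (p (j + n - 1)) r)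
    = on_line L d \<alpha> w (seg j n l (alt r))"
    unfolding bond_commute [of "p (j + n)"]
    unfolding p_def on_line_bond [OF w \<alpha> jL] seg_right [OF assms(4,5)] ..
  have "(p (j + n - 1), p (Suc (j + n - 1))) \<in> nbr_pairs L d"
    unfolding p_def by (rule move_nbr [OF w \<alpha>])
  moreover have "Suc (j + n - 1) = j + n" using assms(5) by simp
  ultimately have nb: "(p (j + n), p (j + n - 1)) \<in> nbr_pairs L d"
    using nbr_pairs_sym by metis
  show ?A unfolding bond_commute [of "p (j + n - 1)"] comm_end(1) [OF nb v assms(4)] sm ..
  show ?B unfolding bond_commute [of "p (j + n - 1)"] by (rule comm_end(2) [OF nb v assms(4)])
qed

lemma seg_layers:
  assumes w: "w \<in> lattice L d" and \<alpha>: "\<alpha> \<in> {1..d}" and "n \<ge> 2"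
    and "on_line L d \<alpha> w (seg j n l r) x \<noteq> None"
  shows "0 \<le> layer L (w \<alpha> + int j) \<alpha> x \<and> layer L (w \<alpha> + int j) \<alpha> x < int n"
proof -
  obtain i where i: "i < L" "x = move L \<alpha> (int i) w" "seg j n l r i \<noteq> None"
    using on_line_dom [OF w \<alpha> assms(4)] .
  then have "j \<le> i" "i < j + n" using seg_dom [OF assms(3)] by auto
  then show ?thesis unfolding i(2) using i(1) by (simp add: layer_line)
qed

text \<open>The word \<open>l Z ... Z (alt r)\<close> with \<open>k + 1\<close> letters is too wide,
  so only the two end removals contribute. Its last letter is \<open>alt r\<close> because removing
  that end then leaves \<open>r\<close>. Both prefactors are nonzero, so consecutive lines determine
  each other's coefficients.\<close>

lemma strip_shift:
  assumes w: "w \<in> lattice L d" and \<alpha>: "\<alpha> \<in> {1..d}" and l: "l \<noteq> PZ" and r: "r \<noteq> PZ" and jk: "j + k < L"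
  shows "of_real (J (alt r)) * phase (Some PZ) (Some (alt r)) * q (on_line L d \<alpha> w (seg j k l r))
    + of_real (J l) * phase (Some PZ) (Some l) * q (on_line L d \<alpha> w (seg (Suc j) k (alt l) (alt r))) = 0"
proof -
  define W where "W = on_line L d \<alpha> w (seg j (Suc k) l (alt r))"
  define p where "p = (\<lambda>i. move L \<alpha> (int i) w)"
  let ?B = "{((p j, p (Suc j)), l), ((p (j + k - 1), p (j + k)), alt r)}"
  have k2: "k \<ge> 2" and jkL: "j < L" "Suc j < L" "j + k - 1 < L" using k3 jk by auto
  have inj: "p i = p i' \<longleftrightarrow> i = i'" if "i < L" "i' < L" for i i'
    unfolding p_def using move_inj [OF w \<alpha> that] by blast
  have pj: "move L \<alpha> 1 (p i) = p (Suc i)" and pm: "move L \<alpha> (- 1) (p (Suc i)) = p i" for i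
    by (simp_all add: p_def move_move)
  have Wp: "W (p i) = seg j (Suc k) l (alt r) i" if "i < L" for i
    unfolding W_def p_def using on_line_move [OF w \<alpha> that] .
  have Wj: "W (p j) = Some l" "W (p (j + k)) = Some (alt r)"
    using Wp [OF jkL(1)] Wp [OF jk] k3 by (simp_all add: seg_def)
  have ne: "p j \<noteq> p (Suc j)" "p (j + k - 1) \<noteq> p (j + k)" "p (j + k) \<noteq> p j" "p (j + k) \<noteq> p (Suc j)"
    using inj [OF jkL(1,2)] inj [OF jkL(3) jk] inj [OF jk jkL(1)] inj [OF jk jkL(2)] k3 by auto
  have Sk: "Suc (j + k - 1) = j + k" using k3 by simp
  have "(\<Sum>((u, v), t)\<in>?B. of_real (J t) * \<kappa> W (bond u v t)) = 0"
  proof (rule bond_sum_terms)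
    show "dom W \<subseteq> lattice L d" unfolding W_def by (rule on_line_lattice)
    have "(p i, p (Suc i)) \<in> nbr_pairs L d" for i
      unfolding p_def by (rule move_nbr [OF w \<alpha>])
    from this [of j] this [of "j + k - 1"] show "?B \<subseteq> nbr_pairs L d \<times> UNIV"
      unfolding Sk by simp
    show "((v, u), t) \<notin> ?B" if "((u, v), t) \<in> ?B" for u v t
      using that ne by auto
    fix P assume P: "ham_term L d P" "\<kappa> W P \<noteq> 0"
    have qP: "q (smul W P) \<noteq> 0" using P(2) by (auto simp: pauli_comm_def)
    show "\<exists>u v t. ((u, v), t) \<in> ?B \<and> P = bond u v t"
    proof (rule two_ends [OF P \<alpha>, where a = "w \<alpha> + int j" and x = "p j" and y = "p (j + k)" and n = "int k"])
      show "layer L (w \<alpha> + int j) \<alpha> x \<le> int k" if "W x \<noteq> None" for x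
        using seg_layers [OF w \<alpha> _ that [unfolded W_def]] k3 by simp
      show "W (p j) \<noteq> None" "W (p (j + k)) \<noteq> None" using Wj by simp_all
      show "layer L (w \<alpha> + int j) \<alpha> (p j) = 0" "layer L (w \<alpha> + int j) \<alpha> (p (j + k)) = int k"
        using jkL jk layer_line [of j j w \<alpha>] layer_line [of j "j + k" w \<alpha>] by (simp_all add: p_def)
      show "fits L \<alpha> (int k) (dom (smul W P))" using q_fits [OF qP \<alpha>] .
      show "\<exists>u v t. ((u, v), t) \<in> ?B \<and> P = bond u v t"
        if "P = bond (p j) (move L \<alpha> 1 (p j)) t" "W (p j) = Some t" for t
        using that Wj unfolding pj by auto
      show "\<exists>u v t. ((u, v), t) \<in> ?B \<and> P = bond u v t"
        if "P = bond (p (j + k)) (move L \<alpha> (- 1) (p (j + k))) t" "W (p (j + k)) = Some t" for t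
      proof -
        have "move L \<alpha> (- 1) (p (j + k)) = p (j + k - 1)" using pm [of "j + k - 1"] Sk by simp
        moreover have "t = alt r" using that(2) Wj by simp
        ultimately show ?thesis using that(1) bond_commute [of "p (j + k)"] by auto
      qed
    qed simp_all
  qed
  moreover have "((p j, p (Suc j)), l) \<noteq> ((p (j + k - 1), p (j + k)), alt r)"
    using ne by auto
  ultimately have "of_real (J l) * \<kappa> W (bond (p j) (p (Suc j)) l)
      + of_real (J (alt r)) * \<kappa> W (bond (p (j + k - 1)) (p (j + k)) (alt r)) = 0"
    by simp
  then have "2 * (of_real (J (alt r)) * phase (Some PZ) (Some (alt r)) * q (on_line L d \<alpha> w (seg j k l r))
    + of_real (J l) * phase (Some PZ) (Some l) * q (on_line L d \<alpha> w (seg (Suc j) k (alt l) (alt r)))) = 0"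
    unfolding W_def p_def using comm_left(1) [OF w \<alpha> l k2 jk, of q "alt r"] comm_right(1) [OF w \<alpha> _ k2 jk, of "alt r" q l] r
    by (simp add: algebra_simps)
  then show ?thesis by (simp del: distrib_left_numeral)
qed

text \<open>As \<open>v\<close> is not a site of the second bond, the two can meet only at
  \<open>x\<close>, and a single common site with different letters gives a sign.\<close>

lemma stub_bond:
  assumes "(x, v) \<in> nbr_pairs L d" "v \<noteq> y" "v \<noteq> z"
  shows "sphase (lattice L d) (bond x v t) (bond y z s)
    = (if (x = y \<or> x = z) \<and> s \<noteq> t then - sphase (lattice L d) (bond y z s) (bond x v t)
       else sphase (lattice L d) (bond y z s) (bond x v t))"
proof -
  have xv: "x \<in> lattice L d" "v \<in> lattice L d" "x \<noteq> v"
    using assms(1) nbr_ne by (auto dest: nbr_pairs_lattice)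
  have "bond y z s v = None" "bond y z s x = (if x = y \<or> x = z then Some s else None)"
    using assms(2,3) by (simp_all add: bond_def)
  then show ?thesis
    unfolding sphase_bond [OF xv finite_lattice] phase_swap by (auto simp: anticomm_def)
qed

text \<open>The \<open>\<beta>\<close>-coordinate is constant along the line. From the tip of the
  attached bond, steps in other directions do not restore it, and a second step forward does not
  either, because the period exceeds 2.\<close>

lemma stub_off_line:
  fixes w \<alpha> \<beta> defines "p \<equiv> \<lambda>i. move L \<alpha> (int i) w"
  assumes "w \<in> lattice L d" "\<alpha> \<in> {1..d}" "\<beta> \<in> {1..d}" "\<beta> \<noteq> \<alpha>"
  shows "p i \<beta> = w \<beta>" "move L \<beta> 1 (p m) \<beta> \<noteq> w \<beta>"
    "move L \<beta> 1 (move L \<beta> 1 (p m)) \<noteq> p i"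
    "\<gamma> \<noteq> \<beta> \<Longrightarrow> move L \<gamma> s (move L \<beta> 1 (p m)) \<noteq> p i"
proof -
  show pb: "p i \<beta> = w \<beta>" for i using assms(5) by (simp add: p_def move_def)
  have L6: "6 \<le> L" using k3 kL by simp
  have lay: "layer L (w \<beta>) \<beta> (move L \<beta> c (p m)) = c mod int L" for c
    unfolding layer_move using pb by (simp add: layer_def)
  show vb: "move L \<beta> 1 (p m) \<beta> \<noteq> w \<beta>"
    using lay [of 1] L6 by (auto simp: layer_def)
  show "move L \<gamma> s (move L \<beta> 1 (p m)) \<noteq> p i" if "\<gamma> \<noteq> \<beta>"
  proof
    assume "move L \<gamma> s (move L \<beta> 1 (p m)) = p i"
    then have "move L \<gamma> s (move L \<beta> 1 (p m)) \<beta> = p i \<beta>" by simp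
    then show False using that vb pb by (simp add: move_def)
  qed
  show "move L \<beta> 1 (move L \<beta> 1 (p m)) \<noteq> p i"
  proof
    assume "move L \<beta> 1 (move L \<beta> 1 (p m)) = p i"
    then have "move L \<beta> 2 (p m) = p i" by (simp add: move_move)
    then have "2 mod int L = 0" using lay [of 2] pb by (simp add: layer_def)
    then show False using L6 by simp
  qed
qed

text \<open>The line with \<open>S\<close> attached has full width but is not straight. A
  contributing term either removes an end of the line, or leaves a string of full width, hence a
  straight line, and so removes the tip of \<open>S\<close>. An end removal drops out when its bond
  meets \<open>S\<close> with a different letter, as it then anticommutes with both factors. The
  conditions at \<open>m = j\<close> and \<open>m = j + n\<close> make \<open>S\<close> anticommute
  with the line there as it does at an interior \<open>PZ\<close>.\<close>

lemma stub_relation: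
  fixes w \<alpha> \<beta> m t
  defines "S \<equiv> bond (move L \<alpha> (int m) w) (move L \<beta> 1 (move L \<alpha> (int m) w)) t"
  assumes w: "w \<in> lattice L d" and \<alpha>: "\<alpha> \<in> {1..d}" and \<beta>: "\<beta> \<in> {1..d}" "\<beta> \<noteq> \<alpha>"
    and l: "l \<noteq> PZ" and r: "r \<noteq> PZ" and t: "t \<noteq> PZ"
    and jn: "j + n < L" and m: "j \<le> m" "m \<le> j + n" and k: "k = Suc n"
    and ml: "m = j \<Longrightarrow> l \<noteq> t" and mr: "m = j + n \<Longrightarrow> r \<noteq> t"
  shows "(if (m = j \<or> m = Suc j) \<and> l \<noteq> t then 0
      else of_real (J l) * phase (Some PZ) (Some l) * attach (lattice L d) q S (on_line L d \<alpha> w (seg (Suc j) n (alt l) r)))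
    + (if (m = j + n - 1 \<or> m = j + n) \<and> r \<noteq> t then 0
      else of_real (J r) * phase (Some PZ) (Some r) * attach (lattice L d) q S (on_line L d \<alpha> w (seg j n l (alt r))))
    + of_real (J t) * q (on_line L d \<alpha> w (seg j k l r)) = 0"
    (is "?left + ?right + ?C = 0")
proof -
  define p where "p = (\<lambda>i. move L \<alpha> (int i) w)"
  define v where "v = move L \<beta> 1 (p m)"
  define D where "D = on_line L d \<alpha> w (seg j k l r)"
  define W where "W = smul D S"
  have S: "S = bond (p m) v t" by (simp add: S_def p_def v_def)
  have n2: "n \<ge> 2" using k k3 by simp
  have mL: "m < L" "j < L" "Suc j < L" "j + n - 1 < L" using m jn n2 by auto
  have inj: "p i = p i' \<longleftrightarrow> i = i'" if "i < L" "i' < L" for i i'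
    unfolding p_def using move_inj [OF w \<alpha> that] by blast
  have pl: "p i \<in> lattice L d" for i unfolding p_def by (rule move_in_lattice [OF w \<alpha>])
  have pb: "p i \<beta> = w \<beta>" for i using stub_off_line(1) [OF w \<alpha> \<beta>] by (simp add: p_def)
  have vb: "v \<beta> \<noteq> w \<beta>" using stub_off_line(2) [OF w \<alpha> \<beta>] by (simp add: p_def v_def)
  have vp: "v \<noteq> p i" for i using pb vb by metis
  have pv: "(p m, v) \<in> nbr_pairs L d" unfolding nbr_pairs_iff v_def using pl \<beta>(1) by blast
  have vl: "v \<in> lattice L d" using pv by (auto dest: nbr_pairs_lattice)
  have pj: "move L \<alpha> 1 (p i) = p (Suc i)" and pm: "move L \<alpha> (- 1) (p (Suc i)) = p i" for i
    by (simp_all add: p_def move_move)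
  have Sn: "Suc (j + n - 1) = j + n" using n2 by simp
  have Dp: "D (p i) = seg j k l r i" if "i < L" for i
    unfolding D_def p_def using on_line_move [OF w \<alpha> that] .
  have Dx: "\<exists>i. j \<le> i \<and> i \<le> j + n \<and> x = p i" if x: "D x \<noteq> None" for x
  proof -
    obtain i where "x = p i" "seg j k l r i \<noteq> None"
      using on_line_dom [OF w \<alpha> x [unfolded D_def]] unfolding p_def by blast
    then show ?thesis using seg_dom [of k j l r i] k n2 by auto
  qed
  have Dv: "D v = None" using Dx vp by blast
  have Wz: "W z = (if z = p m then pmul (D (p m)) (Some t) else if z = v then Some t else D z)" for z
    using Dv vp by (simp add: W_def S smul_def bond_def)
  have Wv: "W v = Some t" using vp by (simp add: Wz)
  have am: "anticomm (D (p m)) t"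
    using m n2 ml mr t k unfolding Dp [OF mL(1)] by (auto simp: seg_def anticomm_def)
  have Wp: "W (p i) \<noteq> None" if "j \<le> i" "i \<le> j + n" for i
  proof (cases "p i = p m")
    case True
    then show ?thesis using am by (simp add: Wz anticomm_def pmul_eq_None)
  next
    case False
    moreover have "D (p i) \<noteq> None" using that jn k n2 seg_dom [of k j l r i] Dp [of i] by simp
    ultimately show ?thesis using vp [of i] by (simp add: Wz)
  qed
  have Wx: "x = v \<or> (\<exists>i. j \<le> i \<and> i \<le> j + n \<and> x = p i)" if "W x \<noteq> None" for x
    using that Dx m by (auto simp: Wz split: if_splits)
  have layp: "layer L (w \<alpha> + int j) \<alpha> (p i) = int i - int j" if "j \<le> i" "i \<le> j + n" for i
    unfolding p_def using layer_line [of j i w \<alpha>] that jn by simp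
  have layv: "layer L (w \<alpha> + int j) \<alpha> v = int m - int j"
    unfolding v_def using layer_move_other [of \<alpha> \<beta>] \<beta>(2) layp [OF m] by metis
  have Wlat: "dom W \<subseteq> lattice L d"
    using Wx pl vl by fastforce
  let ?B = "{((p j, p (Suc j)), l), ((p (j + n - 1), p (j + n)), r), ((p m, v), t)}"
  have ne: "p j \<noteq> p (Suc j)" "p (j + n - 1) \<noteq> p (j + n)" "p (j + n) \<noteq> p j" "p (j + n) \<noteq> p (Suc j)"
    "p (j + n - 1) \<noteq> p j"
    using inj [OF mL(2,3)] inj [OF mL(4) jn] inj [OF jn mL(2)] inj [OF jn mL(3)] inj [OF mL(4,2)] n2 by auto
  have "(\<Sum>((u, v), t)\<in>?B. of_real (J t) * \<kappa> W (bond u v t)) = 0"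
  proof (rule bond_sum_terms [OF Wlat])
    have "(p i, p (Suc i)) \<in> nbr_pairs L d" for i
      unfolding p_def by (rule move_nbr [OF w \<alpha>])
    from this [of j] this [of "j + n - 1"] pv show "?B \<subseteq> nbr_pairs L d \<times> UNIV"
      unfolding Sn by simp
    show "((v', u), t') \<notin> ?B" if "((u, v'), t') \<in> ?B" for u v' t'
      using that ne vp vp [symmetric] by auto
    fix P assume P: "ham_term L d P" "\<kappa> W P \<noteq> 0"
    have qP: "q (smul W P) \<noteq> 0" using P(2) by (auto simp: pauli_comm_def)
    show "\<exists>u v t. ((u, v), t) \<in> ?B \<and> P = bond u v t"
    proof (cases "fits L \<alpha> (int k - 1) (dom (smul W P))")
      case True
      show ?thesis
      proof (rule two_ends [OF P \<alpha>, where a = "w \<alpha> + int j" and x = "p j" and y = "p (j + n)" and n = "int k - 1"])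
        show "layer L (w \<alpha> + int j) \<alpha> x \<le> int k - 1" if "W x \<noteq> None" for x
          using Wx [OF that] layp layv m k by auto
        show "W (p j) \<noteq> None" "W (p (j + n)) \<noteq> None" using Wp by simp_all
        show "layer L (w \<alpha> + int j) \<alpha> (p j) = 0" "layer L (w \<alpha> + int j) \<alpha> (p (j + n)) = int k - 1"
          using layp [of j] layp [of "j + n"] k by simp_all
        show "fits L \<alpha> (int k - 1) (dom (smul W P))" by (fact True)
        show "\<exists>u v t. ((u, v), t) \<in> ?B \<and> P = bond u v t"
          if P': "P = bond (p j) (move L \<alpha> 1 (p j)) t'" "W (p j) = Some t'"
            and uniq: "\<And>z. W z \<noteq> None \<Longrightarrow> layer L (w \<alpha> + int j) \<alpha> z = 0 \<Longrightarrow> z = p j" for t'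
        proof -
          \<comment> \<open>Otherwise the tip \<open>v\<close> would be a second site of layer
            0.\<close>
          have "m \<noteq> j" using uniq [of v] Wv layv vp by auto
          then have "p j \<noteq> p m" using inj mL by simp
          then have "t' = l" using P'(2) Dp [OF mL(2)] vp [of j] by (simp add: Wz seg_def)
          then show ?thesis using P'(1) unfolding pj by auto
        qed
        show "\<exists>u v t. ((u, v), t) \<in> ?B \<and> P = bond u v t"
          if P': "P = bond (p (j + n)) (move L \<alpha> (- 1) (p (j + n))) t'" "W (p (j + n)) = Some t'"
            and uniq: "\<And>z. W z \<noteq> None \<Longrightarrow> layer L (w \<alpha> + int j) \<alpha> z = int k - 1 \<Longrightarrow> z = p (j + n)" for t'
        proof -
          have "m \<noteq> j + n" using uniq [of v] Wv layv vp k by auto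
          then have "p (j + n) \<noteq> p m" using inj mL jn by simp
          then have "t' = r" using P'(2) Dp [OF jn] vp [of "j + n"] k n2 by (simp add: Wz seg_def)
          moreover have "move L \<alpha> (- 1) (p (j + n)) = p (j + n - 1)" using pm [of "j + n - 1"] Sn by simp
          ultimately show ?thesis using P'(1) bond_commute [of "p (j + n)"] by auto
        qed
      qed (use k in simp_all)
    next
      case False
      obtain a where sp: "span \<alpha> a (smul W P)" using span_exists [OF qP \<alpha> False] .
      obtain w' where w': "\<And>x. smul W P x \<noteq> None \<longleftrightarrow> (\<exists>i<k. x = move L \<alpha> (int i) w')"
        by (rule line_support [OF sp]) (rule that)
      have C\<beta>: "x \<beta> = w' \<beta>" if x: "smul W P x \<noteq> None" for x
      proof -
        obtain i where "x = move L \<alpha> (int i) w'" using x w' [of x] by blast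
        then show ?thesis using \<beta>(2) by (simp add: move_def)
      qed
      \<comment> \<open>A line in direction \<open>\<alpha>\<close> through \<open>v\<close> avoids
        all sites \<open>p i\<close>, so at least two sites would have been erased by one
        term.\<close>
      have Cv: "smul W P v = None"
      proof (rule ccontr)
        assume "smul W P v \<noteq> None"
        then have no: "smul W P (p i) = None" for i using C\<beta> [of v] C\<beta> [of "p i"] pb [of i] vb by metis
        have "W (p j) \<noteq> None" "W (p (Suc j)) \<noteq> None" using Wp [of j] Wp [of "Suc j"] n2 by simp_all
        then show False using term_removal [OF P L2, of "p j"] no [of j] no [of "Suc j"] ne(1) by metis
      qed
      have "W v \<noteq> None" using Wv by simp
      from term_removal [OF P L2 this Cv] obtain y t' where y: "(v, y) \<in> nbr_pairs L d" "P = bond v y t'"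
        "W v = Some t'" "anticomm (W y) t'" by metis
      have t': "t' = t" using y(3) Wv by simp
      have "W y \<noteq> None" "y \<noteq> v" using y(1,4) nbr_ne by (auto simp: anticomm_def)
      then obtain i where i: "i \<le> j + n" "y = p i" using Wx by blast
      obtain \<gamma> s where \<gamma>: "y = move L \<gamma> s v" and s: "s = 1 \<or> s = - 1"
        using y(1) unfolding nbr_pairs_iff by blast
      have "\<gamma> = \<beta>" using stub_off_line(4) [OF w \<alpha> \<beta>, of \<gamma> s m i] \<gamma> i(2) unfolding v_def p_def by metis
      moreover have "s = - 1"
        using stub_off_line(3) [OF w \<alpha> \<beta>, of m i] \<gamma> i(2) s \<open>\<gamma> = \<beta>\<close> unfolding v_def p_def by metis
      ultimately have "y = p m" using \<gamma> move_0 [OF pl \<beta>(1)] by (simp add: v_def move_move)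
      then show ?thesis using y(2) t' bond_commute [of v] by auto
    qed
  qed
  moreover have "((p j, p (Suc j)), l) \<notin> {((p (j + n - 1), p (j + n)), r), ((p m, v), t)}"
    "((p (j + n - 1), p (j + n)), r) \<notin> {((p m, v), t)}"
    using ne vp [symmetric] by auto
  ultimately have sum0: "of_real (J l) * \<kappa> W (bond (p j) (p (Suc j)) l)
      + of_real (J r) * \<kappa> W (bond (p (j + n - 1)) (p (j + n)) r) + of_real (J t) * \<kappa> W S = 0"
    by (simp add: S add.assoc)
  let ?F = "attach (lattice L d) q S"
  \<comment> \<open>With this factor the surviving end removals become values of
    \<open>attach\<close>, comparable for different lines, and the term of \<open>S\<close> itself
    loses its phase.\<close>
  define \<sigma> where "\<sigma> = sphase (lattice L d) D S"
  have left: "\<sigma> * \<kappa> W (bond (p j) (p (Suc j)) l) = (if (m = j \<or> m = Suc j) \<and> l \<noteq> t then 0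
      else 2 * (phase (Some PZ) (Some l) * ?F (on_line L d \<alpha> w (seg (Suc j) n (alt l) r))))"
  proof -
    have iff: "p m = p j \<or> p m = p (Suc j) \<longleftrightarrow> m = j \<or> m = Suc j" using inj mL by simp
    note sb = stub_bond [OF pv vp vp, of t j "Suc j" l, unfolded iff, folded S]
    show ?thesis
    proof (cases "(m = j \<or> m = Suc j) \<and> l \<noteq> t")
      case True
      have "sphase (lattice L d) D (bond (p j) (p (Suc j)) l) = - sphase (lattice L d) (bond (p j) (p (Suc j)) l) D"
        using comm_left(2) [OF w \<alpha> l n2 jn, of r] unfolding p_def D_def k by simp
      then have "\<kappa> W (bond (p j) (p (Suc j)) l) = 0"
        unfolding W_def using True sb by (intro attach_anticommute) simp_all
      then show ?thesis using True by simp
    next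
      case False
      then have "\<sigma> * \<kappa> W (bond (p j) (p (Suc j)) l) = pauli_comm (lattice L d) ?F D (bond (p j) (p (Suc j)) l)"
        unfolding W_def \<sigma>_def using sb by (intro attach_commute) (simp only: if_False)
      then show ?thesis
        using comm_left(1) [OF w \<alpha> l n2 jn, of ?F r] unfolding if_not_P [OF False] p_def D_def k by simp
    qed
  qed
  have right: "\<sigma> * \<kappa> W (bond (p (j + n - 1)) (p (j + n)) r) = (if (m = j + n - 1 \<or> m = j + n) \<and> r \<noteq> t then 0
      else 2 * (phase (Some PZ) (Some r) * ?F (on_line L d \<alpha> w (seg j n l (alt r)))))"
  proof -
    have iff: "p m = p (j + n - 1) \<or> p m = p (j + n) \<longleftrightarrow> m = j + n - 1 \<or> m = j + n" using inj mL jn by simp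
    note sb = stub_bond [OF pv vp vp, of t "j + n - 1" "j + n" r, unfolded iff, folded S]
    show ?thesis
    proof (cases "(m = j + n - 1 \<or> m = j + n) \<and> r \<noteq> t")
      case True
      have "sphase (lattice L d) D (bond (p (j + n - 1)) (p (j + n)) r) = - sphase (lattice L d) (bond (p (j + n - 1)) (p (j + n)) r) D"
        using comm_right(2) [OF w \<alpha> r n2 jn, of l] unfolding p_def D_def k by simp
      then have "\<kappa> W (bond (p (j + n - 1)) (p (j + n)) r) = 0"
        unfolding W_def using True sb by (intro attach_anticommute) simp_all
      then show ?thesis using True by simp
    next
      case False
      then have "\<sigma> * \<kappa> W (bond (p (j + n - 1)) (p (j + n)) r) = pauli_comm (lattice L d) ?F D (bond (p (j + n - 1)) (p (j + n)) r)"
        unfolding W_def \<sigma>_def using sb by (intro attach_commute) (simp only: if_False)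
      then show ?thesis
        using comm_right(1) [OF w \<alpha> r n2 jn, of ?F l] unfolding if_not_P [OF False] p_def D_def k by simp
    qed
  qed
  have stub: "\<sigma> * \<kappa> W S = 2 * q D"
  proof -
    have WS: "smul W S = D" by (simp add: W_def)
    \<comment> \<open>Multiplying by \<open>t\<close> twice is the identity, so the two phases
      cancel.\<close>
    have ph: "phase (D (p m)) (Some t) * phase (pmul (D (p m)) (Some t)) (Some t) = 1"
    proof -
      have "pmul (Some t) (Some t) = None" by (simp add: pmul_eq_None)
      then show ?thesis using phase_cocycle [of "D (p m)" "Some t" "Some t"] by (simp add: phase_self)
    qed
    have "\<kappa> W S = 2 * phase (pmul (D (p m)) (Some t)) (Some t) * q D"
    proof -
      have Wm: "W (p m) = pmul (D (p m)) (Some t)" by (simp add: Wz)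
      have "anticomm (W (p m)) t \<noteq> anticomm (W v) t"
        using am by (simp add: Wm Wv anticomm_pmul) (simp add: anticomm_def)
      then have "\<kappa> W S = 2 * (phase (W (p m)) (Some t) * phase (W v) (Some t)) * q (smul W S)"
        unfolding S by (subst pauli_comm_bond [OF pl [of m] vl vp [of m, symmetric] finite_lattice]) (rule if_P)
      then show ?thesis by (simp add: Wm Wv WS phase_self)
    qed
    moreover have "\<sigma> = phase (D (p m)) (Some t)"
      unfolding \<sigma>_def S sphase_bond [OF pl [of m] vl vp [of m, symmetric] finite_lattice] by (simp add: Dv)
    ultimately show ?thesis using ph by (simp add: mult.assoc [symmetric] mult.left_commute [of _ 2])
  qed
  have "of_real (J l) * (\<sigma> * \<kappa> W (bond (p j) (p (Suc j)) l))
      + of_real (J r) * (\<sigma> * \<kappa> W (bond (p (j + n - 1)) (p (j + n)) r)) + of_real (J t) * (\<sigma> * \<kappa> W S) = 0"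
    using arg_cong [OF sum0, of "\<lambda>x. \<sigma> * x"] by (simp add: algebra_simps)
  moreover have "a * (if A then 0 else 2 * (x * y)) = 2 * (if A then 0 else a * x * y)" for a x y :: complex and A
    by simp
  ultimately have "2 * (?left + ?right + ?C) = 0"
    unfolding left right stub D_def by (simp only: distrib_left mult.left_commute [of _ 2])
  then show ?thesis by (simp del: distrib_left_numeral)
qed

end

section \<open>The contradiction from a second direction\<close>

lemma alt_power_neq_PZ: "t \<noteq> PZ \<Longrightarrow> (alt ^^ n) t \<noteq> PZ"
  by (induction n) simp_all

lemma eq_altI: "s \<noteq> PZ \<Longrightarrow> t \<noteq> PZ \<Longrightarrow> s \<noteq> t \<Longrightarrow> s = alt t"
  by (cases s; cases t) simp_all

context conserved
begin

text \<open>The line slides from position 0 up to the bond attached at position \<open>N\<close>.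
  \<open>x n\<close> belongs to the bare line after \<open>n\<close> steps, \<open>e n\<close> to
  the line with \<open>k - 1\<close> letters and the bond attached. In step \<open>n\<close> the
  right removal gives \<open>e n\<close> and the left one \<open>e (Suc n)\<close>, so
  \<open>telescoping\<close> applies once the two extreme terms vanish.\<close>

lemma no_span:
  assumes d: "d \<ge> 2"
  shows "\<not> span \<alpha> a A"
proof
  assume A: "span \<alpha> a A"
  note \<alpha> = spanD(2) [OF A]
  obtain w l r where w: "w \<in> lattice L d" and l: "l \<noteq> PZ" and r: "r \<noteq> PZ"
    and q0: "q (on_line L d \<alpha> w (seg 0 k l r)) \<noteq> 0"
    using strip_start [OF A] by metis
  define \<beta> where "\<beta> = (if \<alpha> = 1 then 2 else 1 :: nat)"
  have \<beta>: "\<beta> \<in> {1..d}" "\<beta> \<noteq> \<alpha>" using d by (auto simp: \<beta>_def)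
  define ln where "ln = (\<lambda>n. (alt ^^ n) l)"
  define rn where "rn = (\<lambda>n. (alt ^^ n) r)"
  have ln: "ln n \<noteq> PZ" "ln (Suc n) = alt (ln n)" and rn: "rn n \<noteq> PZ" "rn (Suc n) = alt (rn n)" for n
    using alt_power_neq_PZ l r by (simp_all add: ln_def rn_def)
  have rn01: "rn 0 = r" "rn 1 = alt r" and ln0: "ln 0 = l" by (simp_all add: rn_def ln_def)
  \<comment> \<open>The left letters alternate, so \<open>ln (k - 3)\<close> or
    \<open>ln (k - 2)\<close> equals \<open>r\<close>. This makes the left removal vanish in the
    last step \<open>n = N - 1\<close>.\<close>
  obtain N where N: "N = k - 2 \<or> N = k - 1" and lN: "ln (N - 1) = r"
  proof (cases "ln (k - 2) = r")
    case True
    then show thesis using that [of "k - 1"] by (simp add: numeral_2_eq_2)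
  next
    case False
    have "k - 2 = Suc (k - 3)" using k3 by simp
    then have "ln (k - 3) = r"
      using eq_altI [OF ln(1) r False] ln(2) [of "k - 3"] by (metis alt_alt)
    then show thesis using that [of "k - 2"] by (simp add: numeral_3_eq_3 numeral_2_eq_2)
  qed
  have N1: "N \<ge> 1" "N < k" using N k3 by auto
  have t: "alt r \<noteq> PZ" "r \<noteq> alt r" using r alt_neq [OF r] by auto
  have kS: "k = Suc (k - 1)" using k3 by simp
  \<comment> \<open>The letter \<open>alt r\<close> differs from the right end \<open>r\<close> of
    step 0, where the right end touches \<open>S\<close>, so that removal vanishes. In later steps
    the end is out of reach of \<open>S\<close> or carries \<open>alt r\<close> itself.\<close>
  define S where "S = bond (move L \<alpha> (int N) w) (move L \<beta> 1 (move L \<alpha> (int N) w)) (alt r)"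
  define c where "c = (\<lambda>t. of_real (J t) * phase (Some PZ) (Some t))"
  define x where "x = (\<lambda>n. q (on_line L d \<alpha> w (seg n k (ln n) (rn n))))"
  define e where "e = (\<lambda>n. attach (lattice L d) q S (on_line L d \<alpha> w (seg n (k - 1) (ln n) (alt (rn n)))))"
  have cne: "c t \<noteq> 0" if "t \<noteq> PZ" for t using J_nonzero [OF that] by (simp add: c_def)
  show False
  proof (rule telescoping [where a = "\<lambda>n. c (rn n)" and b = "\<lambda>n. c (ln n)" and x = x and e = e
        and g = "of_real (J (alt r))" and N = N])
    show "c (rn n) \<noteq> 0" "c (ln n) \<noteq> 0" for n using cne ln rn by simp_all
    show "complex_of_real (J (alt r)) \<noteq> 0" using J_nonzero [OF t(1)] by simp
    show "x 0 \<noteq> 0" using q0 by (simp add: x_def rn01 ln0)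
    show "N \<ge> 1" by (fact N1)
    show "c (rn (Suc n)) * x n + c (ln n) * x (Suc n) = 0" if n: "Suc n < N" for n
    proof -
      have "n + k < L" using n N1 kL by simp
      from strip_shift [OF w \<alpha> ln(1) rn(1) this] show ?thesis
        by (simp add: c_def x_def ln(2) rn(2))
    qed
    show "(if n = 0 then 0 else c (rn n) * e n) + (if Suc n = N then 0 else c (ln n) * e (Suc n))
      + of_real (J (alt r)) * x n = 0" if n: "n < N" for n
    proof -
      have left: "(N = n \<or> N = Suc n) \<and> ln n \<noteq> alt r \<longleftrightarrow> Suc n = N"
      proof
        assume "Suc n = N"
        then have "N - 1 = n" by simp
        then have "ln n = r" using lN by simp
        then show "(N = n \<or> N = Suc n) \<and> ln n \<noteq> alt r" using t(2) \<open>Suc n = N\<close> by simp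
      qed (use n in linarith)
      have right: "(N = n + (k - 1) - 1 \<or> N = n + (k - 1)) \<and> rn n \<noteq> alt r \<longleftrightarrow> n = 0"
      proof (cases "n = 0")
        case True
        have "N = n + (k - 1) - 1 \<or> N = n + (k - 1)" using N True by auto
        then show ?thesis using True t(2) rn01(1) by simp
      next
        case False
        have "n = 1" if "N = n + (k - 1) - 1 \<or> N = n + (k - 1)"
          using that False N k3 by auto
        then show ?thesis using False rn01(2) by metis
      qed
      have "n + (k - 1) < L" "n \<le> N" "N \<le> n + (k - 1)" using n N1 kL by auto
      moreover have "ln n \<noteq> alt r" if "N = n" using that n by simp
      moreover have "rn n \<noteq> alt r" if "N = n + (k - 1)"
        using that N k3 t(2) rn01(1) by (cases "n = 0") auto
      ultimately have "(if (N = n \<or> N = Suc n) \<and> ln n \<noteq> alt r then 0 else of_real (J (ln n)) * phase (Some PZ) (Some (ln n))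
          * attach (lattice L d) q S (on_line L d \<alpha> w (seg (Suc n) (k - 1) (alt (ln n)) (rn n))))
        + (if (N = n + (k - 1) - 1 \<or> N = n + (k - 1)) \<and> rn n \<noteq> alt r then 0 else of_real (J (rn n)) * phase (Some PZ) (Some (rn n))
          * attach (lattice L d) q S (on_line L d \<alpha> w (seg n (k - 1) (ln n) (alt (rn n)))))
        + of_real (J (alt r)) * q (on_line L d \<alpha> w (seg n k (ln n) (rn n))) = 0"
        unfolding S_def by (intro stub_relation [OF w \<alpha> \<beta> ln(1) rn(1) t(1) _ _ _ kS])
      \<comment> \<open>Since \<open>alt (rn (Suc n)) = rn n\<close>, the left removal in step
        \<open>n\<close> is exactly \<open>e (Suc n)\<close>.\<close>
      from this [unfolded left right]
      show ?thesis
        unfolding c_def e_def x_def ln(2) rn(2) alt_alt by (simp only: add_ac)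
    qed
  qed
qed

end

section \<open>Widths and the passage to the abstract setting\<close>

lemma width_dir_property:
  assumes "L > 0"
  shows "\<exists>a\<in>{1..int L}. \<forall>u\<in>S. (u \<alpha> - a) mod int L \<in> {0..<int (width_dir L \<alpha> S)}"
  unfolding width_dir_def
proof (rule LeastI [of "\<lambda>k. \<exists>a\<in>{1..int L}. \<forall>u\<in>S. (u \<alpha> - a) mod int L \<in> {0..<int k}" L])
  show "\<exists>a\<in>{1..int L}. \<forall>u\<in>S. (u \<alpha> - a) mod int L \<in> {0..<int L}"
    using assms by (intro bexI [of _ 1]) auto
qed

text \<open>An arbitrary origin has a representative in one period with the same layers, as
  \<open>width_dir\<close> demands.\<close>

lemma width_dir_le:
  assumes "L > 0" "fits L \<alpha> (int n) S"
  shows "width_dir L \<alpha> S \<le> n"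
proof -
  obtain a where a: "\<And>u. u \<in> S \<Longrightarrow> layer L a \<alpha> u < int n"
    using assms(2) unfolding fits_def by blast
  define b where "b = (a - 1) mod int L + 1"
  have b: "b \<in> {1..int L}"
    using pos_mod_bound [of "int L" "a - 1"] pos_mod_sign [of "int L" "a - 1"] assms(1)
    unfolding b_def atLeastAtMost_iff by linarith
  have "(u \<alpha> - b) mod int L = layer L a \<alpha> u" for u
  proof -
    have "(u \<alpha> - b) mod int L = ((u \<alpha> - 1) - (a - 1) mod int L) mod int L"
      by (simp add: b_def algebra_simps)
    also have "\<dots> = (u \<alpha> - 1 - (a - 1)) mod int L" by (rule mod_diff_right_eq)
    finally show ?thesis by (simp add: layer_def)
  qed
  then have "\<forall>u\<in>S. (u \<alpha> - b) mod int L \<in> {0..<int n}"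
    using a layer_bounds [OF assms(1)] by auto
  then show ?thesis unfolding width_dir_def using b by (intro Least_le) blast
qed

lemma finite_pauli_products: "finite (pauli_products L d)"
proof (rule finite_subset)
  show "pauli_products L d \<subseteq> (\<Union>S\<in>Pow (lattice L d). {A. dom A = S \<and> ran A \<subseteq> UNIV})"
    by (auto simp: pauli_products_def)
  show "finite (\<Union>S\<in>Pow (lattice L d). {A :: site \<rightharpoonup> pauli. dom A = S \<and> ran A \<subseteq> UNIV})"
  proof (rule finite_UN_I)
    fix S assume "S \<in> Pow (lattice L d)"
    then have "finite S" using finite_subset [OF _ finite_lattice] by blast
    then show "finite {A :: site \<rightharpoonup> pauli. dom A = S \<and> ran A \<subseteq> UNIV}"
      by (rule finite_set_of_finite_maps) simp
  qed simp
qed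

theorem theorem2p1:
  fixes d L k_max :: nat and JX JY JZ hX hY hZ :: real
  assumes "d \<ge> 2" and "JX \<noteq> 0" and "JY \<noteq> 0"
    and "3 \<le> k_max" and "real k_max \<le> real L / 2"
  shows "\<not> (\<exists>Q. local_conserved_quantity L d (hamiltonian L d JX JY JZ hX hY hZ) k_max Q)"
proof
  assume "\<exists>Q. local_conserved_quantity L d (hamiltonian L d JX JY JZ hX hY hZ) k_max Q"
  then obtain Q q A where
    Q: "op_eq L d Q (\<lambda>\<sigma> \<tau>. \<Sum>A | A \<in> pauli_products L d \<and> width L d (dom A) \<le> k_max.
          q A * product_op L d A \<sigma> \<tau>)"
    and A: "A \<in> pauli_products L d" "width L d (dom A) = k_max" "q A \<noteq> 0"
    and comm: "op_eq L d (commutator L d (hamiltonian L d JX JY JZ hX hY hZ) Q) (\<lambda>\<sigma> \<tau>. 0)"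
    unfolding local_conserved_quantity_def by blast
  have kL: "2 * k_max \<le> L" using assms(5) by linarith
  then have L: "L \<ge> 2" "L > 0" using assms(4) by auto
  define X where "X = {A \<in> pauli_products L d. width L d (dom A) \<le> k_max}"
  \<comment> \<open>Zero for all strings that are too wide, so that every nonzero coefficient obeys
    the width bound.\<close>
  define q' where "q' = (\<lambda>A. if A \<in> X then q A else 0)"
  have X: "finite X" "\<And>A. A \<in> X \<Longrightarrow> dom A \<subseteq> lattice L d"
    using finite_subset [OF _ finite_pauli_products, of X L d] by (auto simp: X_def pauli_products_def)
  interpret conserved L d k_max "coupling JX JY JZ" "coupling hX hY hZ" q'
  proof
    show "3 \<le> k_max" "2 * k_max \<le> L" by (fact assms(4), fact kL)
    show "coupling JX JY JZ PX \<noteq> 0" "coupling JX JY JZ PY \<noteq> 0"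
      using assms(2,3) by (simp_all add: coupling_def)
    show "dom B \<subseteq> lattice L d" if "q' B \<noteq> 0" for B
      using that X(2) by (auto simp: q'_def split: if_splits)
    show "fits L \<alpha> (int k_max) (dom B)" if "q' B \<noteq> 0" "\<alpha> \<in> {1..d}" for B \<alpha>
    proof -
      have "width L d (dom B) \<le> k_max" using that(1) by (auto simp: q'_def X_def split: if_splits)
      moreover have "width_dir L \<alpha> (dom B) \<le> width L d (dom B)"
        unfolding width_def using that(2) by (intro Max_ge) auto
      ultimately have le: "width_dir L \<alpha> (dom B) \<le> k_max" by simp
      obtain b where b: "\<forall>u\<in>dom B. (u \<alpha> - b) mod int L \<in> {0..<int (width_dir L \<alpha> (dom B))}"
        using width_dir_property [OF L(2)] by blast
      have "layer L b \<alpha> u < int k_max" if "u \<in> dom B" for u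
        using bspec [OF b that] le by (simp add: layer_def)
      then show ?thesis unfolding fits_def by blast
    qed
    show "(\<Sum>((u, v), t)\<in>nbr_pairs L d \<times> UNIV.
          of_real (coupling JX JY JZ t) * pauli_comm (lattice L d) q' W (bond u v t))
     + 2 * (\<Sum>(u, t)\<in>lattice L d \<times> UNIV.
          of_real (coupling hX hY hZ t) * pauli_comm (lattice L d) q' W [u \<mapsto> t]) = 0"
      if "dom W \<subseteq> lattice L d" for W
      by (rule conserved_relation [OF L(1) Q [folded X_def] comm X that]) (simp_all add: q'_def)
  qed
  \<comment> \<open>The maximum over directions is attained. In such a direction \<open>A\<close>
    does not fit into \<open>k_max - 1\<close> layers and therefore has a span.\<close>
  have "width L d (dom A) \<in> (\<lambda>\<alpha>. width_dir L \<alpha> (dom A)) ` {1..d}"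
    unfolding width_def using assms(1) by (intro Max_in) auto
  then obtain \<alpha> where \<alpha>: "\<alpha> \<in> {1..d}" "width_dir L \<alpha> (dom A) = k_max" using A(2) by auto
  have "\<not> fits L \<alpha> (int k_max - 1) (dom A)"
  proof
    assume "fits L \<alpha> (int k_max - 1) (dom A)"
    moreover have "int k_max - 1 = int (k_max - 1)" using assms(4) by simp
    ultimately have "width_dir L \<alpha> (dom A) \<le> k_max - 1" using width_dir_le [OF L(2)] by metis
    then show False using \<alpha>(2) assms(4) by simp
  qed
  moreover have "q' A \<noteq> 0" using A by (simp add: q'_def X_def)
  ultimately obtain a where "span \<alpha> a A" using span_exists \<alpha>(1) by blast
  with no_span assms(1) show False by blast
qed

end
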